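(* Let $L$ be a Lie superalgebra over $\mathbb{F}$ and $H$ a central subalgebra of $L$. Then the sequence $$0\longrightarrow \mathrm{Hom}(L/H, \mathbb{F})\stackrel{\mathrm{Inf}}{\longrightarrow}\mathrm{Hom}(L, \mathbb{F})\stackrel{\mathrm{Res}}{\longrightarrow}\mathrm{Hom}(H, \mathbb{F})\stackrel{\mathrm{Tra}}{\longrightarrow}\mathrm{H}^{2}(L/H, \mathbb{F})\stackrel{\mathrm{Inf}}{\longrightarrow}\mathrm{H}^{2}(L, \mathbb{F})$$ is exact.
   Context: $\mathbb{F}$ is a field of characteristic different from $2,3$; all (super)algebras are over $\mathbb{F}$. For a homogeneous element $x$, $|x|$ denotes its $\mathbb{Z}_2$-degree; formulas containing $|x|$ are for homogeneous elements. Lie superalgebra homomorphisms are even, and ideals and subalgebras are $\mathbb{Z}_2$-graded. $H$ central means $H\subseteq \mathrm{Z}(L)$, the center of $L$. Let $i:H\to L$ be the inclusion and $\pi:L\to L/H$ the canonical projection, so that $0\to H\stackrel{i}{\to} L\stackrel{\pi}{\to}L/H\to 0$ is a central extension. $\mathbb{F}$ is a trivial $L$-module; $H$, $L$, $L/H$ are $L$-modules via the adjoint representation. $\mathrm{Hom}(M,N)$ denotes the space of $L$-module homomorphisms from $M$ to $N$ (even and odd parts both included); a homogeneous homomorphism $g$ satisfies $g(x\cdot m)=(-1)^{|g||x|}x\cdot g(m)$. So $\mathrm{Hom}(L,\mathbb{F})$ (resp. $\mathrm{Hom}(L/H,\mathbb{F})$) consists of the linear maps vanishing on $[L,L]$ (resp.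 $[L/H,L/H]$), and $\mathrm{Hom}(H,\mathbb{F})$ consists of all linear maps $H\to\mathbb{F}$. Cohomology with trivial coefficients: for a Lie superalgebra $G$, $C^2(G,\mathbb{F})$ is the $\mathbb{Z}_2$-graded space of bilinear maps $f:G\times G\to\mathbb{F}$ with $f(x,y)=-(-1)^{|x||y|}f(y,x)$. $\mathrm{Z}^2(G,\mathbb{F})$ is the subspace of those $f$ with $(-1)^{|x||z|}f([x,y],z)+(-1)^{|y||x|}f([y,z],x)+(-1)^{|z||y|}f([z,x],y)=0$ for all $x,y,z\in G$. $\mathrm{B}^2(G,\mathbb{F})$ is the subspace of those $f$ of the form $f(x,y)=-\sigma([x,y])$ for some linear map $\sigma:G\to\mathbb{F}$. $\mathrm{H}^2(G,\mathbb{F})=\mathrm{Z}^2(G,\mathbb{F})/\mathrm{B}^2(G,\mathbb{F})$, and $\bar f$ denotes the class of $f$. The maps: - $\mathrm{Inf}:\mathrm{Hom}(L/H,\mathbb{F})\to\mathrm{Hom}(L,\mathbb{F})$, $f\mapsto f\circ\pi$. - $\mathrm{Res}:\mathrm{Hom}(L,\mathbb{F})\to\mathrm{Hom}(H,\mathbb{F})$, $g\mapsto g\circ i$. - $\mathrm{Tra}:\mathrm{Hom}(H,\mathbb{F})\to\mathrm{H}^2(L/H,\mathbb{F})$, $\alpha\mapsto\overline{\alpha\circ f}$, where $\mu:L/H\to L$ is a section of $\pi$ (an even linear map with $\pi\circ\mu=\mathrm{id}$) and $f(x,y)=[\mu(x),\mu(y)]-\mu([x,y])\in H$ for $x,y\in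 L/H$ is the factor set defined by $\mu$; the class does not depend on the choice of $\mu$. - $\mathrm{Inf}:\mathrm{H}^2(L/H,\mathbb{F})\to\mathrm{H}^2(L,\mathbb{F})$, $\bar\beta\mapsto\overline{\beta'}$, where $\beta'(x,y)=\beta(\pi(x),\pi(y))$ for $x,y\in L$; this is well defined. *)

theory Defs
  imports "HOL-Algebra.Module" "HOL-Algebra.AbelCoset" "HOL-Library.Z2"
begin

section \<open>Linear maps\<close>

text \<open>The fields \<open>mult\<close> and \<open>one\<close>, which module records inherit from rings, carry no
  meaning for vector spaces; the constructions below leave them undefined.\<close>

locale linear_map =
  A?: module F A + B?: module F B + abelian_group_hom A B f
  for F (structure) and A (structure) and B (structure) and f +
  assumes map_smult:
    "\<lbrakk>c \<in> carrier F; x \<in> carrier A\<rbrakk> \<Longrightarrow> f (c \<odot>\<^bsub>A\<^esub> x) = c \<odot>\<^bsub>B\<^esub> f x"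

definition bilinear_map ::
  "('f, 'm) ring_scheme \<Rightarrow> ('f, 'a, 'n) module_scheme \<Rightarrow> ('f, 'b, 'p) module_scheme \<Rightarrow>
   ('f, 'c, 'q) module_scheme \<Rightarrow> ('a \<Rightarrow> 'b \<Rightarrow> 'c) \<Rightarrow> bool" where
  "bilinear_map F A B C f \<longleftrightarrow>
     (\<forall>x\<in>carrier A. linear_map F B C (f x)) \<and> (\<forall>y\<in>carrier B. linear_map F A C (\<lambda>x. f x y))"

definition exact_at ::
  "('f, 'm) ring_scheme \<Rightarrow> ('f, 'a, 'n) module_scheme \<Rightarrow> ('a \<Rightarrow> 'b) \<Rightarrow> ('f, 'b, 'p) module_scheme \<Rightarrow>
   ('b \<Rightarrow> 'c) \<Rightarrow> ('f, 'c, 'q) module_scheme \<Rightarrow> bool" where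
  "exact_at F A f B g C \<longleftrightarrow>
     linear_map F A B f \<and> linear_map F B C g \<and> f ` carrier A = a_kernel B C g"

definition zero_module :: "('f, unit) module" where
  "zero_module = \<lparr>carrier = {()}, mult = undefined, one = undefined, zero = (),
     add = (\<lambda>_ _. ()), smult = (\<lambda>_ _. ())\<rparr>"

text \<open>A set \<open>C\<close> of functions from \<open>S\<close> to \<open>N\<close> with pointwise operations. Functions are
  extensional, i.e. \<open>undefined\<close> outside \<open>S\<close>.\<close>

definition function_module ::
  "'s set \<Rightarrow> ('f, 'b, 'n) module_scheme \<Rightarrow> ('s \<Rightarrow> 'b) set \<Rightarrow> ('f, 's \<Rightarrow> 'b) module" where
  "function_module S N C = \<lparr>carrier = C, mult = undefined, one = undefined,
     zero = (\<lambda>s\<in>S. \<zero>\<^bsub>N\<^esub>),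
     add = (\<lambda>f g. \<lambda>s\<in>S. f s \<oplus>\<^bsub>N\<^esub> g s),
     smult = (\<lambda>c f. \<lambda>s\<in>S. c \<odot>\<^bsub>N\<^esub> f s)\<rparr>"

definition quotient_module ::
  "('f, 'a, 'n) module_scheme \<Rightarrow> 'a set \<Rightarrow> ('f, 'a set) module" where
  "quotient_module M N = \<lparr>carrier = a_rcosets\<^bsub>M\<^esub> N, mult = undefined, one = undefined,
     zero = N, add = set_add M, smult = (\<lambda>c X. \<Union>x\<in>X. N +>\<^bsub>M\<^esub> (c \<odot>\<^bsub>M\<^esub> x))\<rparr>"


section \<open>Lie superalgebras\<close>

text \<open>Degrees live in \<^typ>\<open>bit\<close>, the integers modulo 2; \<open>part V i\<close> is the homogeneous
  component of degree \<open>i\<close>.\<close>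

record ('f, 'v) superspace = "('f, 'v) module" +
  part :: "bit \<Rightarrow> 'v set"

locale superspace = F?: field F + V?: module F V
  for F (structure) and V (structure) +
  assumes part_submodule: "submodule (part V i) F V"
    and part_disjoint: "part V 0 \<inter> part V 1 = {\<zero>\<^bsub>V\<^esub>}"
    and part_sum: "part V 0 <+>\<^bsub>V\<^esub> part V 1 = carrier V"

text \<open>\<open>(-1)\<^sup>i\<close>; since degrees are multiplied modulo 2, \<open>parity_sign F (i * j)\<close> is the
  usual sign for exchanging elements of degrees \<open>i\<close> and \<open>j\<close>.\<close>

definition parity_sign :: "('f, 'm) ring_scheme \<Rightarrow> bit \<Rightarrow> 'f" where
  "parity_sign F i = (if i = 0 then \<one>\<^bsub>F\<^esub> else \<ominus>\<^bsub>F\<^esub> \<one>\<^bsub>F\<^esub>)"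

record ('f, 'v) lie_superalgebra = "('f, 'v) superspace" +
  bracket :: "'v \<Rightarrow> 'v \<Rightarrow> 'v"

locale lie_superalgebra = superspace F L
  for F (structure) and L (structure) +
  assumes bracket_bilinear: "bilinear_map F L L L (bracket L)"
    and bracket_part:
      "\<lbrakk>x \<in> part L i; y \<in> part L j\<rbrakk> \<Longrightarrow> bracket L x y \<in> part L (i + j)"
    and super_skew:
      "\<lbrakk>x \<in> part L i; y \<in> part L j\<rbrakk> \<Longrightarrow>
        bracket L x y = \<ominus>\<^bsub>L\<^esub> (parity_sign F (i * j) \<odot>\<^bsub>L\<^esub> bracket L y x)"
    and super_jacobi:
      "\<lbrakk>x \<in> part L i; y \<in> part L j; z \<in> part L k\<rbrakk> \<Longrightarrow>
        parity_sign F (i * k) \<odot>\<^bsub>L\<^esub> bracket L (bracket L x y) z \<oplus>\<^bsub>L\<^esub>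
        parity_sign F (j * i) \<odot>\<^bsub>L\<^esub> bracket L (bracket L y z) x \<oplus>\<^bsub>L\<^esub>
        parity_sign F (k * j) \<odot>\<^bsub>L\<^esub> bracket L (bracket L z x) y = \<zero>\<^bsub>L\<^esub>"

definition lie_center :: "('f, 'a, 'n) lie_superalgebra_scheme \<Rightarrow> 'a set" where
  "lie_center L = {x \<in> carrier L. \<forall>y\<in>carrier L. bracket L x y = \<zero>\<^bsub>L\<^esub>}"

definition lie_subalgebra ::
  "('f, 'm) ring_scheme \<Rightarrow> ('f, 'a, 'n) lie_superalgebra_scheme \<Rightarrow> 'a set \<Rightarrow> bool" where
  "lie_subalgebra F L H \<longleftrightarrow> submodule H F L \<and>
     H = (H \<inter> part L 0) <+>\<^bsub>L\<^esub> (H \<inter> part L 1) \<and>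
     (\<forall>x\<in>H. \<forall>y\<in>H. bracket L x y \<in> H)"

definition lie_restrict ::
  "('f, 'a) lie_superalgebra \<Rightarrow> 'a set \<Rightarrow> ('f, 'a) lie_superalgebra" where
  "lie_restrict L H = L\<lparr>carrier := H, part := (\<lambda>i. H \<inter> part L i)\<rparr>"

definition lie_proj ::
  "('f, 'a) lie_superalgebra \<Rightarrow> 'a set \<Rightarrow> 'a \<Rightarrow> 'a set" where
  "lie_proj L H x = H +>\<^bsub>L\<^esub> x"

definition lie_quotient ::
  "('f, 'a) lie_superalgebra \<Rightarrow> 'a set \<Rightarrow> ('f, 'a set) lie_superalgebra" where
  "lie_quotient L H = module.extend (quotient_module L H)
     \<lparr>part = (\<lambda>i. lie_proj L H ` part L i),
      bracket = (\<lambda>X Y. \<Union>x\<in>X. \<Union>y\<in>Y. lie_proj L H (bracket L x y))\<rparr>"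


section \<open>Module homomorphisms\<close>

text \<open>\<open>'a\<close> is the type of elements of the Lie superalgebra acting on the module.\<close>

record ('f, 'a, 'v) lie_supermodule = "('f, 'v) superspace" +
  act :: "'a \<Rightarrow> 'v \<Rightarrow> 'v"

definition with_action ::
  "('f, 'v, 'n) superspace_scheme \<Rightarrow> ('a \<Rightarrow> 'v \<Rightarrow> 'v) \<Rightarrow> ('f, 'a, 'v) lie_supermodule" where
  "with_action V \<rho> = superspace.extend (superspace.truncate V) \<lparr>act = \<rho>\<rparr>"

definition base_space :: "('f, 'm) ring_scheme \<Rightarrow> ('f, 'f) superspace" where
  "base_space F = \<lparr>carrier = carrier F, mult = mult F, one = \<one>\<^bsub>F\<^esub>, zero = \<zero>\<^bsub>F\<^esub>, add = add F,
     smult = mult F, part = (\<lambda>i. if i = 0 then carrier F else {\<zero>\<^bsub>F\<^esub>})\<rparr>"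

definition trivial_module :: "('f, 'm) ring_scheme \<Rightarrow> ('f, 'a, 'f) lie_supermodule" where
  "trivial_module F = with_action (base_space F) (\<lambda>_ _. \<zero>\<^bsub>F\<^esub>)"

definition hom_part ::
  "('f, 'm) ring_scheme \<Rightarrow> ('f, 'a) lie_superalgebra \<Rightarrow> ('f, 'a, 'v) lie_supermodule \<Rightarrow>
   ('f, 'a, 'w) lie_supermodule \<Rightarrow> bit \<Rightarrow> ('v \<Rightarrow> 'w) set" where
  "hom_part F L M N d = {g \<in> extensional (carrier M). linear_map F M N g \<and>
     (\<forall>i. g ` part M i \<subseteq> part N (i + d)) \<and>
     (\<forall>i. \<forall>x\<in>part L i. \<forall>m\<in>carrier M.
        g (act M x m) = parity_sign F (d * i) \<odot>\<^bsub>N\<^esub> act N x (g m))}"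

definition hom_space ::
  "('f, 'm) ring_scheme \<Rightarrow> ('f, 'a) lie_superalgebra \<Rightarrow> ('f, 'a, 'v) lie_supermodule \<Rightarrow>
   ('f, 'a, 'w) lie_supermodule \<Rightarrow> ('f, 'v \<Rightarrow> 'w) module" where
  "hom_space F L M N = function_module (carrier M) N
     {\<lambda>m\<in>carrier M. g m \<oplus>\<^bsub>N\<^esub> h m | g h. g \<in> hom_part F L M N 0 \<and> h \<in> hom_part F L M N 1}"

text \<open>\<open>L\<close>, \<open>H\<close> and \<open>L/H\<close> with the adjoint action of \<open>L\<close>.\<close>

definition adjoint_module :: "('f, 'a) lie_superalgebra \<Rightarrow> ('f, 'a, 'a) lie_supermodule" where
  "adjoint_module L = with_action L (bracket L)"

definition adjoint_sub ::
  "('f, 'a) lie_superalgebra \<Rightarrow> 'a set \<Rightarrow> ('f, 'a, 'a) lie_supermodule" where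
  "adjoint_sub L H = with_action (lie_restrict L H) (bracket L)"

definition adjoint_quotient ::
  "('f, 'a) lie_superalgebra \<Rightarrow> 'a set \<Rightarrow> ('f, 'a, 'a set) lie_supermodule" where
  "adjoint_quotient L H = with_action (lie_quotient L H)
     (\<lambda>x. bracket (lie_quotient L H) (lie_proj L H x))"


section \<open>Second cohomology with trivial coefficients\<close>

definition cochains2 ::
  "('f, 'm) ring_scheme \<Rightarrow> ('f, 'a) lie_superalgebra \<Rightarrow> ('a \<times> 'a \<Rightarrow> 'f) set" where
  "cochains2 F G = {f \<in> extensional (carrier G \<times> carrier G).
     bilinear_map F G G (base_space F) (curry f) \<and>
     (\<forall>i j. \<forall>x\<in>part G i. \<forall>y\<in>part G j.
        f (x, y) = \<ominus>\<^bsub>F\<^esub> (parity_sign F (i * j) \<otimes>\<^bsub>F\<^esub> f (y, x)))}"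

definition cocycles2 ::
  "('f, 'm) ring_scheme \<Rightarrow> ('f, 'a) lie_superalgebra \<Rightarrow> ('a \<times> 'a \<Rightarrow> 'f) set" where
  "cocycles2 F G = {f \<in> cochains2 F G.
     \<forall>i j k. \<forall>x\<in>part G i. \<forall>y\<in>part G j. \<forall>z\<in>part G k.
        parity_sign F (i * k) \<otimes>\<^bsub>F\<^esub> f (bracket G x y, z) \<oplus>\<^bsub>F\<^esub>
        parity_sign F (j * i) \<otimes>\<^bsub>F\<^esub> f (bracket G y z, x) \<oplus>\<^bsub>F\<^esub>
        parity_sign F (k * j) \<otimes>\<^bsub>F\<^esub> f (bracket G z x, y) = \<zero>\<^bsub>F\<^esub>}"

definition coboundaries2 ::
  "('f, 'm) ring_scheme \<Rightarrow> ('f, 'a) lie_superalgebra \<Rightarrow> ('a \<times> 'a \<Rightarrow> 'f) set" where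
  "coboundaries2 F G =
     {\<lambda>(x, y)\<in>carrier G \<times> carrier G. \<ominus>\<^bsub>F\<^esub> (\<sigma> (bracket G x y)) | \<sigma>.
        linear_map F G (base_space F) \<sigma>}"

definition cocycle_module ::
  "('f, 'm) ring_scheme \<Rightarrow> ('f, 'a) lie_superalgebra \<Rightarrow> ('f, 'a \<times> 'a \<Rightarrow> 'f) module" where
  "cocycle_module F G =
     function_module (carrier G \<times> carrier G) (base_space F) (cocycles2 F G)"

definition H2 ::
  "('f, 'm) ring_scheme \<Rightarrow> ('f, 'a) lie_superalgebra \<Rightarrow> ('f, ('a \<times> 'a \<Rightarrow> 'f) set) module" where
  "H2 F G = quotient_module (cocycle_module F G) (coboundaries2 F G)"

definition H2_class ::
  "('f, 'm) ring_scheme \<Rightarrow> ('f, 'a) lie_superalgebra \<Rightarrow> ('a \<times> 'a \<Rightarrow> 'f) \<Rightarrow>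
   ('a \<times> 'a \<Rightarrow> 'f) set" where
  "H2_class F G f = coboundaries2 F G +>\<^bsub>cocycle_module F G\<^esub> f"


section \<open>Inflation, restriction and transgression\<close>

definition inf_hom ::
  "('f, 'a) lie_superalgebra \<Rightarrow> 'a set \<Rightarrow> ('a set \<Rightarrow> 'f) \<Rightarrow> ('a \<Rightarrow> 'f)" where
  "inf_hom L H f = compose (carrier L) f (lie_proj L H)"

definition res_hom :: "'a set \<Rightarrow> ('a \<Rightarrow> 'f) \<Rightarrow> ('a \<Rightarrow> 'f)" where
  "res_hom H g = restrict g H"

definition lie_sections ::
  "('f, 'm) ring_scheme \<Rightarrow> ('f, 'a) lie_superalgebra \<Rightarrow> 'a set \<Rightarrow> ('a set \<Rightarrow> 'a) set" where
  "lie_sections F L H = {\<mu>. linear_map F (lie_quotient L H) L \<mu> \<and>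
     (\<forall>i. \<mu> ` part (lie_quotient L H) i \<subseteq> part L i) \<and>
     (\<forall>x\<in>carrier (lie_quotient L H). lie_proj L H (\<mu> x) = x)}"

definition factor_set ::
  "('f, 'a) lie_superalgebra \<Rightarrow> 'a set \<Rightarrow> ('a set \<Rightarrow> 'a) \<Rightarrow> 'a set \<times> 'a set \<Rightarrow> 'a" where
  "factor_set L H \<mu> = (\<lambda>(x, y).
     bracket L (\<mu> x) (\<mu> y) \<ominus>\<^bsub>L\<^esub> \<mu> (bracket (lie_quotient L H) x y))"

text \<open>\<open>the_elem\<close> picks the unique element of a singleton set: the value must be the same
  for all sections, respectively for all representatives.\<close>

definition tra ::
  "('f, 'm) ring_scheme \<Rightarrow> ('f, 'a) lie_superalgebra \<Rightarrow> 'a set \<Rightarrow> ('a \<Rightarrow> 'f) \<Rightarrow>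
   ('a set \<times> 'a set \<Rightarrow> 'f) set" where
  "tra F L H \<alpha> = the_elem
     ((\<lambda>\<mu>. H2_class F (lie_quotient L H)
        (compose (carrier (lie_quotient L H) \<times> carrier (lie_quotient L H)) \<alpha>
          (factor_set L H \<mu>))) ` lie_sections F L H)"

definition inf_H2 ::
  "('f, 'm) ring_scheme \<Rightarrow> ('f, 'a) lie_superalgebra \<Rightarrow> 'a set \<Rightarrow>
   ('a set \<times> 'a set \<Rightarrow> 'f) set \<Rightarrow> ('a \<times> 'a \<Rightarrow> 'f) set" where
  "inf_H2 F L H c = the_elem
     ((\<lambda>\<beta>. H2_class F L
        (\<lambda>(x, y)\<in>carrier L \<times> carrier L. \<beta> (lie_proj L H x, lie_proj L H y))) ` c)"

end

theory Submission
  imports Defs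
begin

text \<open>
  Fix a graded section \<open>\<mu>\<close> of the projection \<open>\<pi>\<close> and put \<open>\<kappa> x = x - \<mu> (\<pi> x)\<close>, a linear map onto \<open>H\<close>
  (\<open>lift_defect \<mu>\<close> below). As \<open>H\<close> is central, the bracket of \<open>L\<close> depends only on classes modulo \<open>H\<close>,
  so the cocycle representing the transgression of \<open>\<alpha>\<close>, inflated to \<open>L\<close>, is
  \<open>\<alpha> (\<kappa> [x, y])\<close>, a coboundary. If it is already equal to \<open>\<sigma> (\<pi> [x, y])\<close>, then
  \<open>\<alpha> \<circ> \<kappa> - \<sigma> \<circ> \<pi>\<close> extends \<open>\<alpha>\<close> to \<open>L\<close> and kills \<open>[L, L]\<close>. Conversely, if a cocycle of
  \<open>L/H\<close> becomes \<open>\<sigma> [x, y]\<close> on \<open>L\<close>, then it differs from the transgression of \<open>\<sigma>|H\<close> by the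
  coboundary \<open>\<sigma> (\<mu> [X, Y])\<close>.
\<close>

section \<open>Linear maps, quotients and complements\<close>

text \<open>Three points carry weight besides the main computation. A graded section has to be
  constructed: dimensions are arbitrary, so complements come from Zorn's lemma and division in the
  field, and they are taken in each degree separately because a complement of \<open>H\<close>
  chosen at once in \<open>L\<close> need not be graded. That \<open>H\<close> itself is graded
  matters too: it makes the two parts of \<open>L/H\<close> meet trivially and lets super skew
  symmetry, stated for homogeneous elements, turn the one-sided condition of
  \<open>lie_center\<close> into a two-sided one. The Hom spaces are sums of an even and an odd part
  of equivariant maps; since the target acts by zero the signs disappear, and splitting a functional
  by degree identifies each Hom space with a space of functionals vanishing on a set. Finally,
  \<open>tra\<close> and \<open>inf_H2\<close> take the unique element of a set of values, so
  independence of the section and of the representative must be proved before either map can be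
  evaluated.\<close>

lemma (in abelian_monoid) add_add_swap:
  "\<lbrakk>a \<in> carrier G; b \<in> carrier G; c \<in> carrier G; d \<in> carrier G\<rbrakk> \<Longrightarrow>
    (a \<oplus> b) \<oplus> (c \<oplus> d) = (a \<oplus> c) \<oplus> (b \<oplus> d)"
  by (simp add: a_ac)

lemma (in abelian_group) minus_eq_zero_iff:
  assumes "a \<in> carrier G" "b \<in> carrier G"
  shows "a \<ominus> b = \<zero> \<longleftrightarrow> a = b"
proof
  assume "a \<ominus> b = \<zero>"
  then have "(a \<ominus> b) \<oplus> b = b" using assms by simp
  then show "a = b" using assms by (simp add: a_minus_def a_assoc l_neg)
qed (use assms in \<open>simp add: a_minus_def r_neg\<close>)

lemma (in abelian_group) minus_zero_right: "x \<in> carrier G \<Longrightarrow> x \<ominus> \<zero> = x"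
  by (simp add: a_minus_def)

lemma linear_mapI:
  assumes "module F A" "module F B"
    and "\<And>x. x \<in> carrier A \<Longrightarrow> f x \<in> carrier B"
    and "\<And>x y. \<lbrakk>x \<in> carrier A; y \<in> carrier A\<rbrakk> \<Longrightarrow> f (x \<oplus>\<^bsub>A\<^esub> y) = f x \<oplus>\<^bsub>B\<^esub> f y"
    and "\<And>c x. \<lbrakk>c \<in> carrier F; x \<in> carrier A\<rbrakk> \<Longrightarrow> f (c \<odot>\<^bsub>A\<^esub> x) = c \<odot>\<^bsub>B\<^esub> f x"
  shows "linear_map F A B f"
proof -
  interpret A: module F A by fact
  interpret B: module F B by fact
  show ?thesis
    by (intro linear_map.intro linear_map_axioms.intro abelian_group_homI group_hom.intro
          group_hom_axioms.intro A.module_axioms B.module_axioms A.abelian_group_axioms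
          B.abelian_group_axioms A.a_group B.a_group)
       (auto intro!: homI simp: assms)
qed

lemma linear_mapD:
  assumes "linear_map F A B f"
  shows linear_map_source: "module F A"
    and linear_map_target: "module F B"
    and linear_map_closed: "\<And>x. x \<in> carrier A \<Longrightarrow> f x \<in> carrier B"
    and linear_map_add:
      "\<And>x y. \<lbrakk>x \<in> carrier A; y \<in> carrier A\<rbrakk> \<Longrightarrow> f (x \<oplus>\<^bsub>A\<^esub> y) = f x \<oplus>\<^bsub>B\<^esub> f y"
    and linear_map_smult:
      "\<And>c x. \<lbrakk>c \<in> carrier F; x \<in> carrier A\<rbrakk> \<Longrightarrow> f (c \<odot>\<^bsub>A\<^esub> x) = c \<odot>\<^bsub>B\<^esub> f x"
    and linear_map_zero: "f \<zero>\<^bsub>A\<^esub> = \<zero>\<^bsub>B\<^esub>"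
    and linear_map_uminus: "\<And>x. x \<in> carrier A \<Longrightarrow> f (\<ominus>\<^bsub>A\<^esub> x) = \<ominus>\<^bsub>B\<^esub> f x"
    and linear_map_minus:
      "\<And>x y. \<lbrakk>x \<in> carrier A; y \<in> carrier A\<rbrakk> \<Longrightarrow> f (x \<ominus>\<^bsub>A\<^esub> y) = f x \<ominus>\<^bsub>B\<^esub> f y"
proof -
  interpret linear_map F A B f by fact
  show "module F A" "module F B" by unfold_locales
  show "f \<zero>\<^bsub>A\<^esub> = \<zero>\<^bsub>B\<^esub>" by simp
  fix x assume x: "x \<in> carrier A"
  then show "f x \<in> carrier B" "f (\<ominus>\<^bsub>A\<^esub> x) = \<ominus>\<^bsub>B\<^esub> f x" by simp_all
  show "f (c \<odot>\<^bsub>A\<^esub> x) = c \<odot>\<^bsub>B\<^esub> f x" if "c \<in> carrier F" for c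
    using that x by (rule map_smult)
  fix y assume y: "y \<in> carrier A"
  show "f (x \<oplus>\<^bsub>A\<^esub> y) = f x \<oplus>\<^bsub>B\<^esub> f y" using x y by simp
  show "f (x \<ominus>\<^bsub>A\<^esub> y) = f x \<ominus>\<^bsub>B\<^esub> f y" using x y by (simp add: a_minus_def)
qed

lemma linear_map_cong:
  assumes "linear_map F A B f" and "\<And>x. x \<in> carrier A \<Longrightarrow> g x = f x"
  shows "linear_map F A B g"
proof -
  interpret linear_map F A B f by fact
  show ?thesis
    by (rule linear_mapI) (simp_all add: assms(2) map_smult A.module_axioms B.module_axioms)
qed

lemma linear_map_compose:
  assumes "linear_map F A B f" and "linear_map F B C g"
  shows "linear_map F A C (\<lambda>x. g (f x))"
  using assms by (intro linear_mapI) (simp_all add: linear_mapD[of F A B f] linear_mapD[of F B C g])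

lemma linear_map_plus:
  assumes f: "linear_map F A B f" and g: "linear_map F A B g"
  shows "linear_map F A B (\<lambda>x. f x \<oplus>\<^bsub>B\<^esub> g x)"
proof -
  interpret B: module F B using f by (rule linear_map_target)
  show ?thesis
    using linear_mapD[OF f] linear_mapD[OF g]
    by (intro linear_mapI) (simp_all add: B.smult_r_distr B.a_ac)
qed

lemma linear_map_scale:
  assumes f: "linear_map F A B f" and c: "c \<in> carrier F"
  shows "linear_map F A B (\<lambda>x. c \<odot>\<^bsub>B\<^esub> f x)"
proof -
  interpret B: module F B using f by (rule linear_map_target)
  show ?thesis
    using linear_mapD[OF f] c
    by (intro linear_mapI) (simp_all add: B.smult_r_distr B.m_comm flip: B.smult_assoc1)
qed

lemma linear_map_neg:
  assumes f: "linear_map F A B f"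
  shows "linear_map F A B (\<lambda>x. \<ominus>\<^bsub>B\<^esub> f x)"
proof -
  interpret B: module F B using f by (rule linear_map_target)
  show ?thesis
    using linear_mapD[OF f]
    by (intro linear_mapI) (simp_all add: B.smult_r_minus B.minus_add)
qed

lemma linear_map_diff:
  assumes f: "linear_map F A B f" and g: "linear_map F A B g"
  shows "linear_map F A B (\<lambda>x. f x \<ominus>\<^bsub>B\<^esub> g x)"
  unfolding a_minus_def by (intro linear_map_plus linear_map_neg f g)

lemma linear_map_const_zero:
  assumes "module F A" "module F B"
  shows "linear_map F A B (\<lambda>x. \<zero>\<^bsub>B\<^esub>)"
proof -
  interpret B: module F B by fact
  show ?thesis using assms by (intro linear_mapI) simp_all
qed

text \<open>The target is only a record here: its module axioms are transported along the
  surjection. Its \<open>zero\<close> is an independent field until then, so compatibility with it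
  is asked for separately.\<close>

lemma surjective_linear_map:
  assumes M: "module F M"
    and surj: "carrier N = h ` carrier M"
    and add: "\<And>x y. \<lbrakk>x \<in> carrier M; y \<in> carrier M\<rbrakk> \<Longrightarrow> h (x \<oplus>\<^bsub>M\<^esub> y) = h x \<oplus>\<^bsub>N\<^esub> h y"
    and smult: "\<And>c x. \<lbrakk>c \<in> carrier F; x \<in> carrier M\<rbrakk> \<Longrightarrow> h (c \<odot>\<^bsub>M\<^esub> x) = c \<odot>\<^bsub>N\<^esub> h x"
    and zero: "h \<zero>\<^bsub>M\<^esub> = \<zero>\<^bsub>N\<^esub>"
  shows "linear_map F M N h"
proof -
  interpret M: module F M by fact
  \<comment> \<open>Oriented to pull operations on images back inside \<open>h\<close>, where the
    axioms of \<open>M\<close> apply.\<close>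
  note [simp] = add[symmetric] smult[symmetric] zero[symmetric]
  have "abelian_group N"
  proof (rule abelian_groupI)
    fix x assume "x \<in> carrier N"
    then obtain a where a: "a \<in> carrier M" "x = h a" by (auto simp: surj)
    have "h (\<ominus>\<^bsub>M\<^esub> a) \<oplus>\<^bsub>N\<^esub> x = \<zero>\<^bsub>N\<^esub>" using a by (simp add: M.l_neg)
    then show "\<exists>y\<in>carrier N. y \<oplus>\<^bsub>N\<^esub> x = \<zero>\<^bsub>N\<^esub>" using a by (auto simp: surj)
  qed (auto simp: surj M.a_ac)
  then have "module F N"
    by (intro moduleI)
       (auto simp: surj M.smult_l_distr M.smult_r_distr M.smult_assoc1 M.cring_axioms)
  then show ?thesis using M by (intro linear_mapI) (auto simp: surj)
qed

text \<open>The identity is a surjection in the sense of \<open>surjective_linear_map\<close>; this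
  moves module structure between records of different types over the same space.\<close>

lemma module_cong:
  assumes "module F M" "carrier N = carrier M" "add N = add M" "zero N = zero M"
    "smult N = smult M"
  shows "module F N"
  using surjective_linear_map[OF assms(1), of N "\<lambda>x. x"] assms(2-) linear_map_target by force

lemma exact_atI:
  assumes "linear_map F A B f" "linear_map F B C g"
    and "\<And>x. x \<in> carrier A \<Longrightarrow> g (f x) = \<zero>\<^bsub>C\<^esub>"
    and "\<And>y. \<lbrakk>y \<in> carrier B; g y = \<zero>\<^bsub>C\<^esub>\<rbrakk> \<Longrightarrow> \<exists>x\<in>carrier A. y = f x"
  shows "exact_at F A f B g C"
  using assms linear_map_closed[OF assms(1)] unfolding exact_at_def a_kernel_def' by blast

lemma module_zero_module: "cring F \<Longrightarrow> module F zero_module"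
  by (intro moduleI abelian_groupI) (auto simp: zero_module_def)

section \<open>Quotients by a submodule\<close>

locale quotient_by_submodule = module F M for F (structure) and M (structure) +
  fixes N
  assumes submodule: "submodule N F M"
begin

lemma is_abelian_subgroup: "abelian_subgroup N M"
  using submodule
  by (intro abelian_subgroupI3 additive_subgroupI M.abelian_group_axioms) (simp add: submodule_def)

sublocale abelian_subgroup N M by (rule is_abelian_subgroup)

lemma coset_eq_iff:
  assumes "x \<in> carrier M" "y \<in> carrier M"
  shows "N +>\<^bsub>M\<^esub> x = N +>\<^bsub>M\<^esub> y \<longleftrightarrow> x \<ominus>\<^bsub>M\<^esub> y \<in> N"
  using assms a_repr_independence' a_repr_independenceD a_rcos_module
  unfolding a_minus_def by metis

lemma coset_zero: "N +>\<^bsub>M\<^esub> \<zero>\<^bsub>M\<^esub> = N"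
  by (simp add: a_subset)

lemma coset_linear_map: "linear_map F M (quotient_module M N) (\<lambda>x. N +>\<^bsub>M\<^esub> x)"
proof (rule surjective_linear_map)
  show "carrier (quotient_module M N) = (\<lambda>x. N +>\<^bsub>M\<^esub> x) ` carrier M"
    by (auto simp: quotient_module_def A_RCOSETS_def')
  fix c x assume c: "c \<in> carrier F" and x: "x \<in> carrier M"
  \<comment> \<open>A scalar multiple in the quotient is a union over all representatives. It
    collapses to one coset because \<open>c\<close> times a difference of representatives stays in
    \<open>N\<close>.\<close>
  have "N +>\<^bsub>M\<^esub> (c \<odot>\<^bsub>M\<^esub> y) = N +>\<^bsub>M\<^esub> (c \<odot>\<^bsub>M\<^esub> x)" if y: "y \<in> N +>\<^bsub>M\<^esub> x" for y
  proof -
    have y': "y \<in> carrier M" using a_elemrcos_carrier[OF x y] .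
    have "y \<ominus>\<^bsub>M\<^esub> x \<in> N" using a_rcos_module_imp[OF x y] unfolding a_minus_def .
    then have "c \<odot>\<^bsub>M\<^esub> (y \<ominus>\<^bsub>M\<^esub> x) \<in> N" using submodule.smult_closed[OF submodule c] by blast
    moreover have "c \<odot>\<^bsub>M\<^esub> (y \<ominus>\<^bsub>M\<^esub> x) = c \<odot>\<^bsub>M\<^esub> y \<ominus>\<^bsub>M\<^esub> c \<odot>\<^bsub>M\<^esub> x"
      using c x y' by (simp add: a_minus_def smult_r_distr smult_r_minus)
    ultimately show ?thesis using c x y' by (simp add: coset_eq_iff)
  qed
  moreover have "x \<in> N +>\<^bsub>M\<^esub> x" using x by (rule a_rcos_self)
  ultimately have "(\<Union>y\<in>N +>\<^bsub>M\<^esub> x. N +>\<^bsub>M\<^esub> (c \<odot>\<^bsub>M\<^esub> y)) = N +>\<^bsub>M\<^esub> (c \<odot>\<^bsub>M\<^esub> x)"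
    by blast
  then show "N +>\<^bsub>M\<^esub> (c \<odot>\<^bsub>M\<^esub> x) = c \<odot>\<^bsub>quotient_module M N\<^esub> (N +>\<^bsub>M\<^esub> x)"
    by (simp add: quotient_module_def)
qed (simp_all add: quotient_module_def a_rcos_sum module_axioms coset_zero)

end

text \<open>Every element of \<open>Q\<close> has the form \<open>p x\<close>, so linearity of
  \<open>g\<close> can be read off from \<open>h\<close>. This serves maps given on representatives:
  the bracket of \<open>L/H\<close> and inflation on second cohomology.\<close>

lemma linear_map_factor:
  assumes p: "linear_map F M Q p" and surj: "carrier Q = p ` carrier M"
    and h: "linear_map F M P h" and g: "\<And>x. x \<in> carrier M \<Longrightarrow> g (p x) = h x"
  shows "linear_map F Q P g"
proof (rule linear_mapI)
  interpret M: module F M using p by (rule linear_map_source)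
  note [simp] = linear_mapD[OF h] g
  note p_simps = linear_map_add[OF p, symmetric] linear_map_smult[OF p, symmetric]
  show "module F Q" using p by (rule linear_map_target)
  show "module F P" using h by (rule linear_map_target)
  show "g x \<in> carrier P" if "x \<in> carrier Q" for x
    using that by (auto simp: surj)
  show "g (x \<oplus>\<^bsub>Q\<^esub> y) = g x \<oplus>\<^bsub>P\<^esub> g y" if "x \<in> carrier Q" "y \<in> carrier Q" for x y
    using that by (auto simp: surj p_simps)
  show "g (c \<odot>\<^bsub>Q\<^esub> x) = c \<odot>\<^bsub>P\<^esub> g x" if "c \<in> carrier F" "x \<in> carrier Q" for c x
    using that by (auto simp: surj p_simps)
qed

lemma module_function_module:
  assumes N: "module F N" and C: "C \<subseteq> S \<rightarrow>\<^sub>E carrier N"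
    and zero: "(\<lambda>s\<in>S. \<zero>\<^bsub>N\<^esub>) \<in> C"
    and add: "\<And>f g. \<lbrakk>f \<in> C; g \<in> C\<rbrakk> \<Longrightarrow> (\<lambda>s\<in>S. f s \<oplus>\<^bsub>N\<^esub> g s) \<in> C"
    and smult: "\<And>c f. \<lbrakk>c \<in> carrier F; f \<in> C\<rbrakk> \<Longrightarrow> (\<lambda>s\<in>S. c \<odot>\<^bsub>N\<^esub> f s) \<in> C"
  shows "module F (function_module S N C)"
proof -
  interpret N: module F N by fact
  note [simp] = function_module_def
  have closed [simp]: "f s \<in> carrier N" if "f \<in> C" "s \<in> S" for f s using that C by auto
  have ext: "f = g" if "f \<in> C" "g \<in> C" "\<And>s. s \<in> S \<Longrightarrow> f s = g s" for f g
    by (rule PiE_ext[of f S "\<lambda>_. carrier N"]) (use that C in auto)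
  show ?thesis
  proof (intro moduleI abelian_groupI)
    fix f assume f: "f \<in> carrier (function_module S N C)"
    \<comment> \<open>Closure of \<open>C\<close> under negation follows from closure under scaling:
      the inverse is the multiple by minus one.\<close>
    let ?g = "\<lambda>s\<in>S. (\<ominus>\<^bsub>F\<^esub> \<one>\<^bsub>F\<^esub>) \<odot>\<^bsub>N\<^esub> f s"
    have "?g \<oplus>\<^bsub>function_module S N C\<^esub> f = \<zero>\<^bsub>function_module S N C\<^esub>"
      using f by (auto intro!: restrict_ext simp: N.smult_l_minus N.l_neg)
    moreover have "?g \<in> carrier (function_module S N C)" using f smult by simp
    ultimately show "\<exists>g\<in>carrier (function_module S N C).
        g \<oplus>\<^bsub>function_module S N C\<^esub> f = \<zero>\<^bsub>function_module S N C\<^esub>" by blast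
  qed (auto intro!: ext N.cring_axioms add smult zero add[unfolded restrict_def]
        smult[unfolded restrict_def] zero[unfolded restrict_def]
        simp: N.a_ac N.smult_l_distr N.smult_r_distr N.smult_assoc1)
qed

section \<open>Complements of submodules over a field\<close>

lemma (in module) submodule_Int:
  assumes "submodule A R M" "submodule B R M"
  shows "submodule (A \<inter> B) R M"
proof -
  have "\<zero>\<^bsub>M\<^esub> \<in> A" "\<zero>\<^bsub>M\<^esub> \<in> B"
    using assms subgroup.one_closed unfolding submodule_def by force+
  then show ?thesis
    using submoduleE[OF assms(1)] submoduleE[OF assms(2)] by (intro submoduleI) auto
qed

text \<open>Zorn's lemma gives a maximal submodule \<open>W\<close> of \<open>B\<close> meeting
  \<open>A\<close> trivially. If some \<open>b\<close> in \<open>B\<close> were outside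
  \<open>A + W\<close>, adjoining the line through \<open>b\<close> would give a larger one.\<close>

lemma (in module) submodule_complement:
  assumes "field R" and A: "submodule A R M" and B: "submodule B R M" and "A \<subseteq> B"
  obtains W where "submodule W R M" "W \<subseteq> B" "A \<inter> W = {\<zero>\<^bsub>M\<^esub>}"
    "\<And>b. b \<in> B \<Longrightarrow> \<exists>a\<in>A. \<exists>w\<in>W. b = a \<oplus>\<^bsub>M\<^esub> w"
proof -
  interpret field R by fact
  note subE = submoduleE
  have zero: "\<zero>\<^bsub>M\<^esub> \<in> U" if "submodule U R M" for U
    using that subgroup.one_closed unfolding submodule_def by force
  have B_closed: "B \<subseteq> carrier M" and A_closed: "A \<subseteq> carrier M"
    using A B by (simp_all add: subE(1))
  define S where "S = {W. submodule W R M \<and> W \<subseteq> B \<and> A \<inter> W = {\<zero>\<^bsub>M\<^esub>}}"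
  have "submodule {\<zero>\<^bsub>M\<^esub>} R M" by (rule submoduleI) auto
  then have "S \<noteq> {}" unfolding S_def using zero[OF A] zero[OF B] by blast
  moreover have "\<Union>C \<in> S" if "C \<noteq> {}" and C: "subset.chain S C" for C
  proof -
    have CS: "\<And>W. W \<in> C \<Longrightarrow> submodule W R M \<and> W \<subseteq> B \<and> A \<inter> W = {\<zero>\<^bsub>M\<^esub>}"
      using C unfolding S_def subset.chain_def by blast
    have "submodule (\<Union>C) R M"
    proof (rule submoduleI)
      show "\<Union>C \<subseteq> carrier M" using CS B_closed by blast
      show "\<zero>\<^bsub>M\<^esub> \<in> \<Union>C" using \<open>C \<noteq> {}\<close> CS by blast
      show "\<ominus>\<^bsub>M\<^esub> a \<in> \<Union>C" if "a \<in> \<Union>C" for a using that CS subE(3) by blast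
      show "a \<odot>\<^bsub>M\<^esub> x \<in> \<Union>C" if "a \<in> carrier R" "x \<in> \<Union>C" for a x
        using that CS subE(4) by blast
      show "a \<oplus>\<^bsub>M\<^esub> b \<in> \<Union>C" if ab: "a \<in> \<Union>C" "b \<in> \<Union>C" for a b
      proof -
        \<comment> \<open>Members of a chain are comparable, so both summands already lie in a
          single member.\<close>
        obtain U V where "U \<in> C" "a \<in> U" "V \<in> C" "b \<in> V" using ab by blast
        moreover from this have "U \<subseteq> V \<or> V \<subseteq> U" using C unfolding subset.chain_def by blast
        ultimately obtain T where "T \<in> C" "a \<in> T" "b \<in> T" by blast
        then show ?thesis using CS subE(5) by blast
      qed
    qed
    then show ?thesis using CS \<open>C \<noteq> {}\<close> unfolding S_def by blast
  qed
  ultimately obtain W where W: "W \<in> S" and max: "\<And>X. \<lbrakk>X \<in> S; W \<subseteq> X\<rbrakk> \<Longrightarrow> X = W"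
    using subset_Zorn_nonempty[of S] by blast
  have Wsub: "submodule W R M" and "W \<subseteq> B" and AW: "A \<inter> W = {\<zero>\<^bsub>M\<^esub>}" using W by (auto simp: S_def)
  have W_closed: "W \<subseteq> carrier M" using \<open>W \<subseteq> B\<close> B_closed by blast
  have "\<exists>a\<in>A. \<exists>w\<in>W. b = a \<oplus>\<^bsub>M\<^esub> w" if b: "b \<in> B" for b
  proof (rule ccontr)
    assume no: "\<not> (\<exists>a\<in>A. \<exists>w\<in>W. b = a \<oplus>\<^bsub>M\<^esub> w)"
    have bc: "b \<in> carrier M" using b B_closed by blast
    \<comment> \<open>The sum of \<open>W\<close> and the line spanned by \<open>b\<close>.\<close>
    define X where "X = (\<lambda>(w, c). w \<oplus>\<^bsub>M\<^esub> c \<odot>\<^bsub>M\<^esub> b) ` (W \<times> carrier R)"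
    have XI: "w \<oplus>\<^bsub>M\<^esub> c \<odot>\<^bsub>M\<^esub> b \<in> X" if "w \<in> W" "c \<in> carrier R" for w c
      using that unfolding X_def by auto
    have "W \<subseteq> X"
    proof
      fix w assume "w \<in> W" then show "w \<in> X" using XI[of w \<zero>] bc W_closed by auto
    qed
    have "X \<subseteq> B" unfolding X_def using b \<open>W \<subseteq> B\<close> subE(4,5)[OF B] by auto
    have "submodule X R M"
    proof (rule submoduleI)
      show "X \<subseteq> carrier M" using \<open>X \<subseteq> B\<close> B_closed by blast
      show "\<zero>\<^bsub>M\<^esub> \<in> X" using \<open>W \<subseteq> X\<close> zero[OF Wsub] by blast
      fix x assume "x \<in> X"
      then obtain w c where w: "w \<in> W" "w \<in> carrier M" and c: "c \<in> carrier R"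
        and x: "x = w \<oplus>\<^bsub>M\<^esub> c \<odot>\<^bsub>M\<^esub> b" unfolding X_def using W_closed by auto
      have "\<ominus>\<^bsub>M\<^esub> x = \<ominus>\<^bsub>M\<^esub> w \<oplus>\<^bsub>M\<^esub> (\<ominus> c) \<odot>\<^bsub>M\<^esub> b"
        using x w c bc by (simp add: M.minus_add smult_l_minus)
      then show "\<ominus>\<^bsub>M\<^esub> x \<in> X" using XI[of "\<ominus>\<^bsub>M\<^esub> w" "\<ominus> c"] subE(3)[OF Wsub w(1)] c by simp
      show "d \<odot>\<^bsub>M\<^esub> x \<in> X" if d: "d \<in> carrier R" for d
        using XI[of "d \<odot>\<^bsub>M\<^esub> w" "d \<otimes> c"] subE(4)[OF Wsub d w(1)] c d w bc
        by (simp add: x smult_r_distr smult_assoc1)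
      fix y assume "y \<in> X"
      then obtain v d where v: "v \<in> W" "v \<in> carrier M" and d: "d \<in> carrier R"
        and y: "y = v \<oplus>\<^bsub>M\<^esub> d \<odot>\<^bsub>M\<^esub> b" unfolding X_def using W_closed by auto
      have "x \<oplus>\<^bsub>M\<^esub> y = (w \<oplus>\<^bsub>M\<^esub> v) \<oplus>\<^bsub>M\<^esub> (c \<oplus> d) \<odot>\<^bsub>M\<^esub> b"
        using w v c d bc by (simp add: x y smult_l_distr M.a_ac)
      then show "x \<oplus>\<^bsub>M\<^esub> y \<in> X" using XI subE(5)[OF Wsub w(1) v(1)] c d by simp
    qed
    moreover have "A \<inter> X = {\<zero>\<^bsub>M\<^esub>}"
    proof -
      have "x = \<zero>\<^bsub>M\<^esub>" if "x \<in> A" "x \<in> X" for x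
      proof -
        obtain w c where w: "w \<in> W" "w \<in> carrier M" and c: "c \<in> carrier R"
          and x: "x = w \<oplus>\<^bsub>M\<^esub> c \<odot>\<^bsub>M\<^esub> b" using \<open>x \<in> X\<close> unfolding X_def using W_closed by auto
        have xc: "x \<in> carrier M" using that A_closed by blast
        show ?thesis
        proof (cases "c = \<zero>")
          case True
          then have "x = w" using x w bc by simp
          then show ?thesis using AW w that by blast
        next
          case False
          \<comment> \<open>With \<open>c\<close> invertible, \<open>x = w + c b\<close> can be
            solved for \<open>b\<close>, which then lies in \<open>A + W\<close>, contrary to
            \<open>no\<close>.\<close>
          then have d: "inv c \<in> carrier R" "inv c \<otimes> c = \<one>" using c field_Units by auto
          have "c \<odot>\<^bsub>M\<^esub> b = x \<oplus>\<^bsub>M\<^esub> \<ominus>\<^bsub>M\<^esub> w" using x w c bc by (simp add: M.a_ac M.r_neg2)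
          then have "inv c \<odot>\<^bsub>M\<^esub> (c \<odot>\<^bsub>M\<^esub> b) = inv c \<odot>\<^bsub>M\<^esub> x \<oplus>\<^bsub>M\<^esub> inv c \<odot>\<^bsub>M\<^esub> (\<ominus>\<^bsub>M\<^esub> w)"
            using d xc w by (simp add: smult_r_distr)
          then have "b = inv c \<odot>\<^bsub>M\<^esub> x \<oplus>\<^bsub>M\<^esub> inv c \<odot>\<^bsub>M\<^esub> (\<ominus>\<^bsub>M\<^esub> w)"
            using d c bc by (simp flip: smult_assoc1)
          then show ?thesis
            using no subE(4)[OF A d(1) \<open>x \<in> A\<close>] subE(4)[OF Wsub d(1) subE(3)[OF Wsub w(1)]] by blast
        qed
      qed
      then show ?thesis using zero[OF A] zero[OF Wsub] \<open>W \<subseteq> X\<close> by blast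
    qed
    ultimately have "X = W" using max \<open>X \<subseteq> B\<close> \<open>W \<subseteq> X\<close> unfolding S_def by blast
    \<comment> \<open>\<open>b\<close> is the element of \<open>X\<close> with \<open>w = 0\<close>
      and \<open>c = 1\<close>; once in \<open>W\<close> it has the excluded form
      \<open>0 + b\<close>.\<close>
    then have "b \<in> W" using XI[OF zero[OF Wsub] R.one_closed] bc by simp
    then show False using no zero[OF A] bc by force
  qed
  then show thesis using that Wsub \<open>W \<subseteq> B\<close> AW by blast
qed

section \<open>Linear functionals and homomorphisms into the trivial module\<close>

text \<open>The same spaces occur as modules, superspaces, supermodules and Lie superalgebras; this
  carries a linear map from one record type to another.\<close>

lemma linear_map_transport:
  assumes f: "linear_map F A B f"
    and "carrier A' = carrier A" "add A' = add A" "zero A' = zero A" "smult A' = smult A"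
    and "carrier B' = carrier B" "add B' = add B" "zero B' = zero B" "smult B' = smult B"
  shows "linear_map F A' B' f"
proof (rule linear_mapI)
  show "module F A'" by (rule module_cong[OF linear_map_source[OF f]]) (simp_all add: assms)
  show "module F B'" by (rule module_cong[OF linear_map_target[OF f]]) (simp_all add: assms)
qed (simp_all add: assms linear_mapD[OF f])

lemma base_space_simps [simp]:
  "carrier (base_space F) = carrier F" "add (base_space F) = add F"
  "zero (base_space F) = zero F" "smult (base_space F) = mult F"
  "part (base_space F) i = (if i = 0 then carrier F else {\<zero>\<^bsub>F\<^esub>})"
  "a_inv (base_space F) = a_inv F"
  by (simp_all add: base_space_def a_inv_def m_inv_def fun_eq_iff)

lemma a_minus_base_space [simp]: "x \<ominus>\<^bsub>base_space F\<^esub> y = x \<ominus>\<^bsub>F\<^esub> y"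
  by (simp add: a_minus_def)

lemma with_action_simps [simp]:
  "carrier (with_action V \<rho>) = carrier V" "add (with_action V \<rho>) = add V"
  "zero (with_action V \<rho>) = zero V" "smult (with_action V \<rho>) = smult V"
  "part (with_action V \<rho>) = part V" "act (with_action V \<rho>) = \<rho>"
  by (simp_all add: with_action_def superspace.defs)

lemma trivial_module_simps [simp]:
  "carrier (trivial_module F) = carrier F" "add (trivial_module F) = add F"
  "zero (trivial_module F) = zero F" "smult (trivial_module F) = mult F"
  "part (trivial_module F) i = (if i = 0 then carrier F else {\<zero>\<^bsub>F\<^esub>})"
  "act (trivial_module F) = (\<lambda>_ _. \<zero>\<^bsub>F\<^esub>)"
  by (simp_all add: trivial_module_def)

lemma module_base_space: "cring F \<Longrightarrow> module F (base_space F)"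
proof -
  assume "cring F"
  then interpret cring F .
  show ?thesis
    by (intro moduleI abelian_groupI cring_axioms)
      (auto simp: a_ac m_assoc l_distr r_distr intro: bexI[where x = "\<ominus>\<^bsub>F\<^esub> _"] l_neg)
qed

text \<open>The common shape of the three Hom spaces. \<open>D\<close> may be any set, not a
  subspace: by linearity, vanishing on generators is enough.\<close>

definition functional_module ::
  "('f, 'm) ring_scheme \<Rightarrow> ('f, 'v, 'n) module_scheme \<Rightarrow> 'v set \<Rightarrow> ('f, 'v \<Rightarrow> 'f) module" where
  "functional_module F V D = function_module (carrier V) (base_space F)
     {f \<in> extensional (carrier V). linear_map F V (base_space F) f \<and> (\<forall>x\<in>D. f x = \<zero>\<^bsub>F\<^esub>)}"

lemma functional_module_simps [simp]:
  "carrier (functional_module F V D) =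
    {f \<in> extensional (carrier V). linear_map F V (base_space F) f \<and> (\<forall>x\<in>D. f x = \<zero>\<^bsub>F\<^esub>)}"
  "add (functional_module F V D) = (\<lambda>f g. \<lambda>x\<in>carrier V. f x \<oplus>\<^bsub>F\<^esub> g x)"
  "zero (functional_module F V D) = (\<lambda>x\<in>carrier V. \<zero>\<^bsub>F\<^esub>)"
  "smult (functional_module F V D) = (\<lambda>c f. \<lambda>x\<in>carrier V. c \<otimes>\<^bsub>F\<^esub> f x)"
  by (simp_all add: functional_module_def function_module_def)

context module
begin

lemma functionalD:
  assumes "linear_map R M (base_space R) f"
  shows "\<And>x. x \<in> carrier M \<Longrightarrow> f x \<in> carrier R"
    and "\<And>x y. \<lbrakk>x \<in> carrier M; y \<in> carrier M\<rbrakk> \<Longrightarrow> f (x \<oplus>\<^bsub>M\<^esub> y) = f x \<oplus> f y"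
    and "\<And>c x. \<lbrakk>c \<in> carrier R; x \<in> carrier M\<rbrakk> \<Longrightarrow> f (c \<odot>\<^bsub>M\<^esub> x) = c \<otimes> f x"
    and "f \<zero>\<^bsub>M\<^esub> = \<zero>"
    and "\<And>x. x \<in> carrier M \<Longrightarrow> f (\<ominus>\<^bsub>M\<^esub> x) = \<ominus> f x"
    and "\<And>x y. \<lbrakk>x \<in> carrier M; y \<in> carrier M\<rbrakk> \<Longrightarrow> f (x \<ominus>\<^bsub>M\<^esub> y) = f x \<ominus> f y"
  using linear_mapD[OF assms] by simp_all

lemma functional_restrict:
  assumes "linear_map R M B f"
  shows "linear_map R M B (\<lambda>x\<in>carrier M. f x)"
  by (rule linear_map_cong[OF assms]) simp

lemma module_functional_module:
  assumes D: "D \<subseteq> carrier M"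
  shows "module R (functional_module R M D)"
proof -
  have K: "module R (base_space R)" by (rule module_base_space) (rule R.cring_axioms)
  show ?thesis
    unfolding functional_module_def
  proof (rule module_function_module[OF K], goal_cases)
    case 1
    show ?case by (auto simp: PiE_def functionalD)
  next
    case 2
    show ?case using D functional_restrict[OF linear_map_const_zero[OF module_axioms K]] by auto
  next
    case (3 f g)
    then show ?case using D functional_restrict[OF linear_map_plus[of R M "base_space R" f g]] by auto
  next
    case (4 c f)
    then show ?case using D functional_restrict[OF linear_map_scale[of R M "base_space R" f c]] by auto
  qed
qed

end

section \<open>Superspaces\<close>

text \<open>Expanding sums of degrees into case distinctions would hide the pattern \<open>i + 1\<close>.\<close>

declare add_bit_eq_xor [simp del]

lemma bit_parity_cases: "(k::bit) = i \<or> k = i + 1"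
  by (cases k; cases i) auto

lemma bit_add_twice: "i + (k + i) = (k::bit)" "i + (k + i + 1) = k + 1" "i + 1 + 1 = i"
  by (cases i; cases k; simp)+

context superspace
begin

lemma part_closed: "part V i \<subseteq> carrier V"
  using submoduleE(1)[OF part_submodule] .

lemma part_in_carrier [simp, intro]: "x \<in> part V i \<Longrightarrow> x \<in> carrier V"
  using part_closed by blast

lemma part_add [simp, intro]: "\<lbrakk>x \<in> part V i; y \<in> part V i\<rbrakk> \<Longrightarrow> x \<oplus>\<^bsub>V\<^esub> y \<in> part V i"
  using submoduleE(5)[OF part_submodule] .

lemma part_smult [simp, intro]: "\<lbrakk>c \<in> carrier F; y \<in> part V i\<rbrakk> \<Longrightarrow> c \<odot>\<^bsub>V\<^esub> y \<in> part V i"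
  using submoduleE(4)[OF part_submodule] .

lemma part_minus [simp, intro]: "\<lbrakk>x \<in> part V i; y \<in> part V i\<rbrakk> \<Longrightarrow> x \<ominus>\<^bsub>V\<^esub> y \<in> part V i"
  using submoduleE(3,5)[OF part_submodule] unfolding a_minus_def by blast

lemma part_zero [simp, intro]: "\<zero>\<^bsub>V\<^esub> \<in> part V i"
  using subgroup.one_closed part_submodule[of i] unfolding submodule_def by force

lemma part_disjointD: "\<lbrakk>x \<in> part V i; x \<in> part V (i + 1)\<rbrakk> \<Longrightarrow> x = \<zero>\<^bsub>V\<^esub>"
  using part_disjoint by (cases i) auto

section \<open>Homogeneous components\<close>

lemma homogeneous_decomposition:
  assumes "x \<in> carrier V"
  obtains a b where "a \<in> part V i" "b \<in> part V (i + 1)" "x = a \<oplus>\<^bsub>V\<^esub> b"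
proof -
  have "x \<in> part V 0 <+>\<^bsub>V\<^esub> part V 1" using assms part_sum by simp
  then obtain a b where ab: "a \<in> part V 0" "b \<in> part V 1" "x = a \<oplus>\<^bsub>V\<^esub> b"
    unfolding set_add_def' by blast
  show thesis
  proof (cases "i = 0")
    case True
    then show thesis using that ab by simp
  next
    case False
    then have "i = 1" by simp
    then show thesis using that[of b a] ab by (simp add: V.M.a_comm)
  qed
qed

lemma homogeneous_induct [consumes 1, case_names homogeneous add]:
  assumes "x \<in> carrier V"
    and "\<And>i x. x \<in> part V i \<Longrightarrow> P x"
    and "\<And>x y. \<lbrakk>x \<in> carrier V; y \<in> carrier V; P x; P y\<rbrakk> \<Longrightarrow> P (x \<oplus>\<^bsub>V\<^esub> y)"
  shows "P x"
  using homogeneous_decomposition[OF assms(1), of 0] assms(2,3) by (metis part_in_carrier)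

text \<open>The projection onto degree \<open>i\<close> along the other degree, which is
  \<open>i + 1\<close> modulo 2. The description is meaningful by
  \<open>component_add\<close>.\<close>

definition component :: "bit \<Rightarrow> 'c \<Rightarrow> 'c" where
  "component i x = (THE a. a \<in> part V i \<and> (\<exists>b\<in>part V (i + 1). x = a \<oplus>\<^bsub>V\<^esub> b))"

lemma component_add:
  assumes "a \<in> part V i" "b \<in> part V (i + 1)"
  shows "component i (a \<oplus>\<^bsub>V\<^esub> b) = a"
  unfolding component_def
proof (rule the_equality)
  show "a \<in> part V i \<and> (\<exists>b'\<in>part V (i + 1). a \<oplus>\<^bsub>V\<^esub> b = a \<oplus>\<^bsub>V\<^esub> b')" using assms by blast
  fix a' assume "a' \<in> part V i \<and> (\<exists>b'\<in>part V (i + 1). a \<oplus>\<^bsub>V\<^esub> b = a' \<oplus>\<^bsub>V\<^esub> b')"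
  then obtain b' where a': "a' \<in> part V i" and b': "b' \<in> part V (i + 1)"
    and eq: "a \<oplus>\<^bsub>V\<^esub> b = a' \<oplus>\<^bsub>V\<^esub> b'" by blast
  have [simp]: "a \<in> carrier V" "a' \<in> carrier V" "b \<in> carrier V" "b' \<in> carrier V"
    using assms a' b' by auto
  \<comment> \<open>Two decompositions of one vector differ by \<open>a' - a = b - b'\<close>, which
    lies in both parts and hence vanishes.\<close>
  have "b \<ominus>\<^bsub>V\<^esub> b' = (\<ominus>\<^bsub>V\<^esub> a \<oplus>\<^bsub>V\<^esub> (a \<oplus>\<^bsub>V\<^esub> b)) \<ominus>\<^bsub>V\<^esub> b'"
    by (simp add: V.M.r_neg1)
  also have "\<dots> = a' \<ominus>\<^bsub>V\<^esub> a"
    unfolding eq by (simp add: a_minus_def V.M.a_assoc V.M.r_neg) (simp add: V.M.a_comm)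
  finally have "a' \<ominus>\<^bsub>V\<^esub> a = b \<ominus>\<^bsub>V\<^esub> b'" ..
  then have "a' \<ominus>\<^bsub>V\<^esub> a \<in> part V (i + 1)" using assms b' by simp
  then have "a' \<ominus>\<^bsub>V\<^esub> a = \<zero>\<^bsub>V\<^esub>" using part_disjointD[of "a' \<ominus>\<^bsub>V\<^esub> a" i] a' assms by blast
  then show "a' = a" by (simp add: V.M.minus_eq_zero_iff)
qed

lemma component_in_part [simp, intro]: "x \<in> carrier V \<Longrightarrow> component i x \<in> part V i"
  by (metis homogeneous_decomposition component_add)

lemma component_closed [simp]: "x \<in> carrier V \<Longrightarrow> component i x \<in> carrier V"
  using component_in_part by blast

lemma component_sum:
  assumes "x \<in> carrier V" shows "component i x \<oplus>\<^bsub>V\<^esub> component (i + 1) x = x"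
proof -
  obtain a b where ab: "a \<in> part V i" "b \<in> part V (i + 1)" "x = a \<oplus>\<^bsub>V\<^esub> b"
    using homogeneous_decomposition[OF assms] .
  have "component (i + 1) (b \<oplus>\<^bsub>V\<^esub> a) = b"
    using ab by (intro component_add) (simp_all only: bit_add_twice)
  moreover have "b \<oplus>\<^bsub>V\<^esub> a = x" using ab V.M.a_comm by blast
  moreover have "component i x = a" using ab component_add by blast
  ultimately show ?thesis using ab by simp
qed

lemma component_same: "x \<in> part V i \<Longrightarrow> component i x = x"
  using component_add[of x i "\<zero>\<^bsub>V\<^esub>"] by simp

lemma component_other: "x \<in> part V (i + 1) \<Longrightarrow> component i x = \<zero>\<^bsub>V\<^esub>"
  using component_add[of "\<zero>\<^bsub>V\<^esub>" i x] by simp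

text \<open>The degree \<open>k\<close> part of \<open>T x\<close> comes from degree
  \<open>k - i\<close>, and modulo 2 this is \<open>k + i\<close>.\<close>

lemma component_homogeneous_map:
  assumes T: "linear_map F V V T" and deg: "\<And>j x. x \<in> part V j \<Longrightarrow> T x \<in> part V (i + j)"
    and x: "x \<in> carrier V"
  shows "component k (T x) = T (component (k + i) x)"
proof -
  let ?a = "component (k + i) x" and ?b = "component (k + i + 1) x"
  have "T ?a \<in> part V k" "T ?b \<in> part V (k + 1)"
    using deg[OF component_in_part[OF x, of "k + i"]] deg[OF component_in_part[OF x, of "k + i + 1"]]
    by (simp_all only: bit_add_twice)
  moreover have "T x = T ?a \<oplus>\<^bsub>V\<^esub> T ?b"
    using linear_map_add[OF T part_in_carrier part_in_carrier,
        OF component_in_part[OF x] component_in_part[OF x], of "k + i" "k + i + 1"]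
    by (simp only: component_sum[OF x])
  ultimately show ?thesis by (simp add: component_add)
qed

lemma component_linear: "linear_map F V V (component i)"
proof (rule linear_mapI)
  fix x y assume xy: "x \<in> carrier V" "y \<in> carrier V"
  let ?a = "component i x" and ?b = "component (i + 1) x"
  let ?c = "component i y" and ?d = "component (i + 1) y"
  have [simp]: "?a \<in> carrier V" "?b \<in> carrier V" "?c \<in> carrier V" "?d \<in> carrier V"
    using xy by blast+
  have "x \<oplus>\<^bsub>V\<^esub> y = (?a \<oplus>\<^bsub>V\<^esub> ?b) \<oplus>\<^bsub>V\<^esub> (?c \<oplus>\<^bsub>V\<^esub> ?d)"
    using xy by (simp only: component_sum)
  also have "\<dots> = (?a \<oplus>\<^bsub>V\<^esub> ?c) \<oplus>\<^bsub>V\<^esub> (?b \<oplus>\<^bsub>V\<^esub> ?d)"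
    by (rule V.M.add_add_swap) simp_all
  finally show "component i (x \<oplus>\<^bsub>V\<^esub> y) = ?a \<oplus>\<^bsub>V\<^esub> ?c"
    using xy by (simp add: component_add)
next
  fix c x assume cx: "c \<in> carrier F" "x \<in> carrier V"
  let ?a = "component i x" and ?b = "component (i + 1) x"
  have [simp]: "?a \<in> carrier V" "?b \<in> carrier V" using cx by blast+
  have "c \<odot>\<^bsub>V\<^esub> x = c \<odot>\<^bsub>V\<^esub> ?a \<oplus>\<^bsub>V\<^esub> c \<odot>\<^bsub>V\<^esub> ?b"
    using cx component_sum[of x i] by (simp flip: smult_r_distr)
  then show "component i (c \<odot>\<^bsub>V\<^esub> x) = c \<odot>\<^bsub>V\<^esub> ?a"
    using cx by (simp add: component_add)
qed (auto intro: module_axioms)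

lemma parity_sign_closed [simp, intro]: "parity_sign F i \<in> carrier F"
  by (simp add: parity_sign_def)

text \<open>The action on the target is zero, so equivariance of either parity says that the map
  kills all \<open>\<rho> x v\<close>, whatever the sign. A functional with this property splits by
  degree, and both pieces keep it because each \<open>\<rho> x\<close> is homogeneous. The
  hypothesis \<open>vanish\<close> translates the property into vanishing on
  \<open>D\<close>.\<close>

lemma hom_space_trivial:
  fixes L :: "('a, 'x) lie_superalgebra" and \<rho> :: "'x \<Rightarrow> 'c \<Rightarrow> 'c"
  assumes lin: "\<And>i x. x \<in> part L i \<Longrightarrow> linear_map F V V (\<rho> x)"
    and deg: "\<And>i j x v. \<lbrakk>x \<in> part L i; v \<in> part V j\<rbrakk> \<Longrightarrow> \<rho> x v \<in> part V (i + j)"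
    and vanish: "\<And>f. linear_map F V (base_space F) f \<Longrightarrow>
      (\<forall>v\<in>D. f v = \<zero>) \<longleftrightarrow> (\<forall>i. \<forall>x\<in>part L i. \<forall>v\<in>carrier V. f (\<rho> x v) = \<zero>)"
  shows "hom_space F L (with_action V \<rho>) (trivial_module F) = functional_module F V D"
proof -
  let ?M = "with_action V \<rho>" and ?T = "trivial_module F :: ('a, 'x, 'a) lie_supermodule" and ?K = "base_space F"
  have lin_iff: "linear_map F ?M ?T f \<longleftrightarrow> linear_map F V ?K f" for f
    by (auto elim!: linear_map_transport)
  note fD = functionalD
  have hom_part_D: "f \<in> extensional (carrier V)" "linear_map F V ?K f"
    "\<And>i x v. \<lbrakk>x \<in> part L i; v \<in> carrier V\<rbrakk> \<Longrightarrow> f (\<rho> x v) = \<zero>"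
    if "f \<in> hom_part F L ?M ?T d" for f d
    using that by (auto simp: hom_part_def lin_iff)
  let ?C = "{\<lambda>v\<in>carrier ?M. g v \<oplus>\<^bsub>?T\<^esub> h v | g h. g \<in> hom_part F L ?M ?T 0 \<and> h \<in> hom_part F L ?M ?T 1}"
  have "?C = carrier (functional_module F V D)"
  proof (intro equalityI subsetI)
    fix f assume "f \<in> ?C"
    then obtain g h where g: "g \<in> hom_part F L ?M ?T 0" and h: "h \<in> hom_part F L ?M ?T 1"
      and f: "f = (\<lambda>v\<in>carrier V. g v \<oplus> h v)" by auto
    have f_lin: "linear_map F V ?K f"
      unfolding f using linear_map_plus[OF hom_part_D(2)[OF g] hom_part_D(2)[OF h]]
      by (intro functional_restrict) simp
    have "f (\<rho> x v) = \<zero>" if "x \<in> part L i" "v \<in> carrier V" for i x v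
      using that hom_part_D(3)[OF g] hom_part_D(3)[OF h] linear_map_closed[OF lin] by (simp add: f)
    then show "f \<in> carrier (functional_module F V D)"
      using f_lin vanish[OF f_lin] by (auto simp: f)
  next
    fix f assume "f \<in> carrier (functional_module F V D)"
    then have f_ext: "f \<in> extensional (carrier V)" and f_lin: "linear_map F V ?K f"
      and f_zero: "\<And>i x v. \<lbrakk>x \<in> part L i; v \<in> carrier V\<rbrakk> \<Longrightarrow> f (\<rho> x v) = \<zero>"
      using vanish by auto
    \<comment> \<open>The field sits in degree 0, so a functional is homogeneous of degree
      \<open>d\<close> when it sees only the component of degree \<open>d\<close>.\<close>
    define g where "g d = (\<lambda>v\<in>carrier V. f (component d v))" for d
    have "g d \<in> hom_part F L ?M ?T d" for d
    proof -
      have "linear_map F V ?K (g d)"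
        unfolding g_def by (intro functional_restrict linear_map_compose[OF component_linear f_lin])
      moreover have "g d v \<in> part ?T (i + d)" if v: "v \<in> part V i" for i v
      proof (cases "i = d")
        case True
        then show ?thesis using v fD(1)[OF f_lin] by (cases d) (auto simp: g_def component_same)
      next
        case False
        then have "i = d + 1" using bit_parity_cases by blast
        then show ?thesis using v fD(1,4)[OF f_lin] by (auto simp: g_def component_other)
      qed
      \<comment> \<open>The component of \<open>\<rho> x v\<close> is again a value of
        \<open>\<rho> x\<close>, taken at another component of \<open>v\<close>, and
        \<open>f\<close> vanishes there.\<close>
      moreover have "g d (\<rho> x v) = \<zero>" if "x \<in> part L i" "v \<in> carrier V" for i x v
        using that component_homogeneous_map[OF lin[OF that(1)] deg[OF that(1)] that(2), of d]
          f_zero linear_map_closed[OF lin]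
        by (auto simp: g_def)
      moreover have "g d \<in> extensional (carrier ?M)" by (simp add: g_def)
      ultimately show ?thesis
        unfolding hom_part_def lin_iff by (simp add: image_subset_iff)
    qed
    moreover have "f = (\<lambda>v\<in>carrier V. g 0 v \<oplus> g 1 v)"
    proof (rule extensionalityI[OF f_ext restrict_extensional])
      fix v assume v: "v \<in> carrier V"
      have "f v = f (component 0 v \<oplus>\<^bsub>V\<^esub> component 1 v)" using v component_sum[of v 0] by simp
      also have "\<dots> = f (component 0 v) \<oplus> f (component 1 v)" using v by (intro fD[OF f_lin]) auto
      finally show "f v = (\<lambda>v\<in>carrier V. g 0 v \<oplus> g 1 v) v" using v by (simp add: g_def)
    qed
    ultimately show "f \<in> ?C" by auto
  qed
  then show ?thesis
    by (simp add: hom_space_def functional_module_def function_module_def)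
qed

end

section \<open>Second cohomology\<close>

lemma bilinear_mapD:
  assumes "bilinear_map F A B C f"
  shows "x \<in> carrier A \<Longrightarrow> linear_map F B C (f x)"
    and "y \<in> carrier B \<Longrightarrow> linear_map F A C (\<lambda>x. f x y)"
  using assms unfolding bilinear_map_def by blast+

lemma bilinear_map_cong:
  assumes "bilinear_map F A B C f"
    and "\<And>x y. \<lbrakk>x \<in> carrier A; y \<in> carrier B\<rbrakk> \<Longrightarrow> g x y = f x y"
  shows "bilinear_map F A B C g"
  unfolding bilinear_map_def
  using bilinear_mapD[OF assms(1)] assms(2) linear_map_cong by metis

lemma bilinear_map_plus:
  assumes "bilinear_map F A B C f" "bilinear_map F A B C g"
  shows "bilinear_map F A B C (\<lambda>x y. f x y \<oplus>\<^bsub>C\<^esub> g x y)"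
  unfolding bilinear_map_def
  by (intro conjI ballI linear_map_plus bilinear_mapD[OF assms(1)] bilinear_mapD[OF assms(2)])

lemma bilinear_map_scale:
  assumes "bilinear_map F A B C f" "c \<in> carrier F"
  shows "bilinear_map F A B C (\<lambda>x y. c \<odot>\<^bsub>C\<^esub> f x y)"
  unfolding bilinear_map_def
  by (intro conjI ballI linear_map_scale bilinear_mapD[OF assms(1)] assms(2))

lemma bilinear_map_compose:
  assumes f: "bilinear_map F B B C f" and p: "linear_map F A B p" and q: "linear_map F C D q"
  shows "bilinear_map F A A D (\<lambda>x y. q (f (p x) (p y)))"
  unfolding bilinear_map_def
proof (intro conjI ballI)
  fix x assume "x \<in> carrier A"
  then have "p x \<in> carrier B" using p by (rule linear_map_closed[rotated])
  then show "linear_map F A D (\<lambda>y. q (f (p x) (p y)))" "linear_map F A D (\<lambda>y. q (f (p y) (p x)))"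
    using linear_map_compose[OF linear_map_compose[OF p bilinear_mapD(1)[OF f]] q]
      linear_map_compose[OF linear_map_compose[OF p bilinear_mapD(2)[OF f]] q] by blast+
qed

context lie_superalgebra
begin

lemma bracket_closed [simp, intro]:
  "\<lbrakk>x \<in> carrier L; y \<in> carrier L\<rbrakk> \<Longrightarrow> bracket L x y \<in> carrier L"
  using linear_map_closed[OF bilinear_mapD(1)[OF bracket_bilinear]] .

lemma bracket_linear:
  assumes "x \<in> carrier L"
  shows bracket_linear_right: "linear_map F L L (bracket L x)"
    and bracket_linear_left: "linear_map F L L (\<lambda>y. bracket L y x)"
  using assms bilinear_mapD[OF bracket_bilinear] by blast+

end

text \<open>No further hypothesis is added: the locale fixes the plain record type that the
  cohomology constants expect, and it is used for both \<open>L\<close> and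
  \<open>L/H\<close>.\<close>

locale lie_cohomology = lie_superalgebra F L
  for F :: "('f, 'm) ring_scheme" (structure) and L :: "('f, 'v) lie_superalgebra" (structure)
begin

abbreviation K where "K \<equiv> base_space F"

lemma module_K: "module F K"
  by (rule module_base_space) (rule F.cring_axioms)

lemma cochain_bilinear: "f \<in> cochains2 F L \<Longrightarrow> bilinear_map F L L K (\<lambda>x y. f (x, y))"
  unfolding cochains2_def curry_def by blast

lemma cochain_closed:
  assumes "f \<in> cochains2 F L" "x \<in> carrier L" "y \<in> carrier L" shows "f (x, y) \<in> carrier F"
  using linear_map_closed[OF bilinear_mapD(1)[OF cochain_bilinear]] assms by fastforce

lemma cocycle_cochain: "f \<in> cocycles2 F L \<Longrightarrow> f \<in> cochains2 F L"
  by (simp add: cocycles2_def)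

lemma cocycleI:
  assumes "f \<in> extensional (carrier L \<times> carrier L)"
    and "bilinear_map F L L K (\<lambda>x y. f (x, y))"
    and "\<And>i j x y. \<lbrakk>x \<in> part L i; y \<in> part L j\<rbrakk> \<Longrightarrow>
        f (x, y) = \<ominus> (parity_sign F (i * j) \<otimes> f (y, x))"
    and "\<And>i j k x y z. \<lbrakk>x \<in> part L i; y \<in> part L j; z \<in> part L k\<rbrakk> \<Longrightarrow>
        parity_sign F (i * k) \<otimes> f (bracket L x y, z) \<oplus>
        parity_sign F (j * i) \<otimes> f (bracket L y z, x) \<oplus>
        parity_sign F (k * j) \<otimes> f (bracket L z x, y) = \<zero>"
  shows "f \<in> cocycles2 F L"
  unfolding cocycles2_def cochains2_def curry_def
  using assms(1,2) by (auto simp only: mem_Collect_eq intro!: assms(3,4))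

lemma cocycleD:
  assumes "f \<in> cocycles2 F L"
  shows "f \<in> extensional (carrier L \<times> carrier L)"
    and "bilinear_map F L L K (\<lambda>x y. f (x, y))"
    and "\<And>i j x y. \<lbrakk>x \<in> part L i; y \<in> part L j\<rbrakk> \<Longrightarrow>
        f (x, y) = \<ominus> (parity_sign F (i * j) \<otimes> f (y, x))"
    and "\<And>i j k x y z. \<lbrakk>x \<in> part L i; y \<in> part L j; z \<in> part L k\<rbrakk> \<Longrightarrow>
        parity_sign F (i * k) \<otimes> f (bracket L x y, z) \<oplus>
        parity_sign F (j * i) \<otimes> f (bracket L y z, x) \<oplus>
        parity_sign F (k * j) \<otimes> f (bracket L z x, y) = \<zero>"
    and "\<And>x y. \<lbrakk>x \<in> carrier L; y \<in> carrier L\<rbrakk> \<Longrightarrow> f (x, y) \<in> carrier F"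
proof -
  have f: "f \<in> cochains2 F L" using assms by (rule cocycle_cochain)
  note skew = f[unfolded cochains2_def, THEN CollectD]
  show "f \<in> extensional (carrier L \<times> carrier L)" using skew by (rule conjunct1)
  show "bilinear_map F L L K (\<lambda>x y. f (x, y))" using f by (rule cochain_bilinear)
  show "\<And>x y. \<lbrakk>x \<in> carrier L; y \<in> carrier L\<rbrakk> \<Longrightarrow> f (x, y) \<in> carrier F"
    using f by (rule cochain_closed)
  show "\<And>i j x y. \<lbrakk>x \<in> part L i; y \<in> part L j\<rbrakk> \<Longrightarrow>
      f (x, y) = \<ominus> (parity_sign F (i * j) \<otimes> f (y, x))"
    by (rule skew[THEN conjunct2, THEN conjunct2, rule_format])
  show "\<And>i j k x y z. \<lbrakk>x \<in> part L i; y \<in> part L j; z \<in> part L k\<rbrakk> \<Longrightarrow>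
      parity_sign F (i * k) \<otimes> f (bracket L x y, z) \<oplus>
      parity_sign F (j * i) \<otimes> f (bracket L y z, x) \<oplus>
      parity_sign F (k * j) \<otimes> f (bracket L z x, y) = \<zero>"
    by (rule assms[unfolded cocycles2_def, THEN CollectD, THEN conjunct2, rule_format])
qed

lemma module_cocycle_module: "module F (cocycle_module F L)"
  unfolding cocycle_module_def
proof (rule module_function_module[OF module_K], goal_cases)
  case 1
  show ?case
  proof
    fix f assume "f \<in> cocycles2 F L"
    then show "f \<in> carrier L \<times> carrier L \<rightarrow>\<^sub>E carrier K"
      using cocycleD(1,5)[of f] by (intro PiE_I) (auto dest: extensional_arb)
  qed
next
  case 2
  show ?case
  proof (rule cocycleI)
    show "bilinear_map F L L K (\<lambda>x y. (\<lambda>s\<in>carrier L \<times> carrier L. \<zero>\<^bsub>K\<^esub>) (x, y))"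
      by (rule bilinear_map_cong[where f = "\<lambda>x y. \<zero>\<^bsub>K\<^esub>"])
        (simp_all add: bilinear_map_def linear_map_const_zero[OF module_axioms module_K,
          unfolded base_space_simps])
    fix i j x y assume x: "x \<in> part L i" and y: "y \<in> part L j"
    have [simp]: "x \<in> carrier L" "y \<in> carrier L" using x y by auto
    show "(\<lambda>s\<in>carrier L \<times> carrier L. \<zero>\<^bsub>K\<^esub>) (x, y) =
        \<ominus> (parity_sign F (i * j) \<otimes> (\<lambda>s\<in>carrier L \<times> carrier L. \<zero>\<^bsub>K\<^esub>) (y, x))" by simp
    fix k z assume z: "z \<in> part L k"
    have [simp]: "z \<in> carrier L" using z by auto
    show "parity_sign F (i * k) \<otimes> (\<lambda>s\<in>carrier L \<times> carrier L. \<zero>\<^bsub>K\<^esub>) (bracket L x y, z) \<oplus>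
        parity_sign F (j * i) \<otimes> (\<lambda>s\<in>carrier L \<times> carrier L. \<zero>\<^bsub>K\<^esub>) (bracket L y z, x) \<oplus>
        parity_sign F (k * j) \<otimes> (\<lambda>s\<in>carrier L \<times> carrier L. \<zero>\<^bsub>K\<^esub>) (bracket L z x, y) = \<zero>" by simp
  qed (rule restrict_extensional)
next
  case (3 f g)
  note f = cocycleD[OF 3(1)] and g = cocycleD[OF 3(2)]
  show ?case
  proof (rule cocycleI)
    have "bilinear_map F L L K (\<lambda>x y. f (x, y) \<oplus>\<^bsub>K\<^esub> g (x, y))"
      using f(2) g(2) by (rule bilinear_map_plus)
    then show "bilinear_map F L L K
        (\<lambda>x y. (\<lambda>s\<in>carrier L \<times> carrier L. f s \<oplus>\<^bsub>K\<^esub> g s) (x, y))"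
      by (rule bilinear_map_cong) simp
    fix i j x y assume x: "x \<in> part L i" and y: "y \<in> part L j"
    have [simp]: "x \<in> carrier L" "y \<in> carrier L" using x y by auto
    show "(\<lambda>s\<in>carrier L \<times> carrier L. f s \<oplus>\<^bsub>K\<^esub> g s) (x, y) =
        \<ominus> (parity_sign F (i * j) \<otimes> (\<lambda>s\<in>carrier L \<times> carrier L. f s \<oplus>\<^bsub>K\<^esub> g s) (y, x))"
      using f(3)[OF x y] g(3)[OF x y] f(5)[of y x] g(5)[of y x]
      by (simp add: F.r_distr F.minus_add)
    fix k z assume z: "z \<in> part L k"
    have [simp]: "z \<in> carrier L" using z by auto
    let ?s = "parity_sign F (i * k)" and ?t = "parity_sign F (j * i)" and ?u = "parity_sign F (k * j)"
    let ?J = "\<lambda>f. ?s \<otimes> f (bracket L x y, z) \<oplus> ?t \<otimes> f (bracket L y z, x) \<oplus> ?u \<otimes> f (bracket L z x, y)"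
    have "?J (\<lambda>s\<in>carrier L \<times> carrier L. f s \<oplus>\<^bsub>K\<^esub> g s) = ?J f \<oplus> ?J g"
      using f(5) g(5) by (simp add: F.r_distr F.a_ac)
    then show "?J (\<lambda>s\<in>carrier L \<times> carrier L. f s \<oplus>\<^bsub>K\<^esub> g s) = \<zero>"
      using f(4)[OF x y z] g(4)[OF x y z] by simp
  qed (rule restrict_extensional)
next
  case (4 c f)
  note c = 4(1) and f = cocycleD[OF 4(2)]
  show ?case
  proof (rule cocycleI)
    have "bilinear_map F L L K (\<lambda>x y. c \<odot>\<^bsub>K\<^esub> f (x, y))"
      using f(2) c by (rule bilinear_map_scale)
    then show "bilinear_map F L L K
        (\<lambda>x y. (\<lambda>s\<in>carrier L \<times> carrier L. c \<odot>\<^bsub>K\<^esub> f s) (x, y))"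
      by (rule bilinear_map_cong) simp
    fix i j x y assume x: "x \<in> part L i" and y: "y \<in> part L j"
    have [simp]: "x \<in> carrier L" "y \<in> carrier L" using x y by auto
    show "(\<lambda>s\<in>carrier L \<times> carrier L. c \<odot>\<^bsub>K\<^esub> f s) (x, y) =
        \<ominus> (parity_sign F (i * j) \<otimes> (\<lambda>s\<in>carrier L \<times> carrier L. c \<odot>\<^bsub>K\<^esub> f s) (y, x))"
      using f(3)[OF x y] f(5)[of y x] c by (simp add: F.r_minus F.m_lcomm)
    fix k z assume z: "z \<in> part L k"
    have [simp]: "z \<in> carrier L" using z by auto
    let ?s = "parity_sign F (i * k)" and ?t = "parity_sign F (j * i)" and ?u = "parity_sign F (k * j)"
    let ?J = "\<lambda>f. ?s \<otimes> f (bracket L x y, z) \<oplus> ?t \<otimes> f (bracket L y z, x) \<oplus> ?u \<otimes> f (bracket L z x, y)"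
    have "?J (\<lambda>s\<in>carrier L \<times> carrier L. c \<odot>\<^bsub>K\<^esub> f s) = c \<otimes> ?J f"
      using f(5) c by (simp add: F.r_distr F.m_lcomm)
    then show "?J (\<lambda>s\<in>carrier L \<times> carrier L. c \<odot>\<^bsub>K\<^esub> f s) = \<zero>"
      using f(4)[OF x y z] c by simp
  qed (rule restrict_extensional)
qed

lemma cocycle_module_simps [simp]:
  "carrier (cocycle_module F L) = cocycles2 F L"
  "zero (cocycle_module F L) = (\<lambda>s\<in>carrier L \<times> carrier L. \<zero>)"
  "add (cocycle_module F L) = (\<lambda>f g. \<lambda>s\<in>carrier L \<times> carrier L. f s \<oplus> g s)"
  "smult (cocycle_module F L) = (\<lambda>c f. \<lambda>s\<in>carrier L \<times> carrier L. c \<otimes> f s)"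
  by (simp_all add: cocycle_module_def function_module_def)

text \<open>Both coboundaries and the values of the transgression have the following shape.\<close>

lemma pullback_cocycle:
  fixes G :: "('f, 'g) lie_superalgebra"
  assumes G: "lie_superalgebra F G"
    and \<nu>: "linear_map F G L \<nu>" and even: "\<And>i x. x \<in> part G i \<Longrightarrow> \<nu> x \<in> part L i"
    and \<sigma>: "linear_map F L K \<sigma>"
    and mult: "\<And>x y z. \<lbrakk>x \<in> carrier G; y \<in> carrier G; z \<in> carrier G\<rbrakk> \<Longrightarrow>
      \<sigma> (bracket L (\<nu> (bracket G x y)) (\<nu> z)) = \<sigma> (bracket L (bracket L (\<nu> x) (\<nu> y)) (\<nu> z))"
  shows "(\<lambda>(x, y)\<in>carrier G \<times> carrier G. \<sigma> (bracket L (\<nu> x) (\<nu> y))) \<in> cocycles2 F G"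
proof -
  interpret G: lie_cohomology F G using G by (rule lie_cohomology.intro)
  note [simp] = functionalD[OF \<sigma>] linear_map_closed[OF \<nu>]
  show ?thesis
  proof (rule G.cocycleI)
    show "bilinear_map F G G K
        (\<lambda>x y. (\<lambda>(x, y)\<in>carrier G \<times> carrier G. \<sigma> (bracket L (\<nu> x) (\<nu> y))) (x, y))"
      by (rule bilinear_map_cong[OF bilinear_map_compose[OF bracket_bilinear \<nu> \<sigma>]]) simp
    fix i j x y assume x: "x \<in> part G i" and y: "y \<in> part G j"
    have [simp]: "x \<in> carrier G" "y \<in> carrier G" using x y by auto
    show "(\<lambda>(x, y)\<in>carrier G \<times> carrier G. \<sigma> (bracket L (\<nu> x) (\<nu> y))) (x, y) =
        \<ominus> (parity_sign F (i * j) \<otimes> (\<lambda>(x, y)\<in>carrier G \<times> carrier G. \<sigma> (bracket L (\<nu> x) (\<nu> y))) (y, x))"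
      using super_skew[OF even[OF x] even[OF y]] by simp
    fix k z assume z: "z \<in> part G k"
    have [simp]: "z \<in> carrier G" using z by auto
    let ?f = "\<lambda>x y. \<sigma> (bracket L (\<nu> x) (\<nu> y))" and ?g = "\<lambda>x y z. \<sigma> (bracket L (bracket L (\<nu> x) (\<nu> y)) (\<nu> z))"
    \<comment> \<open>The Jacobi identity of \<open>L\<close> for the images under \<nu>, with the
      functional \<sigma> applied to it.\<close>
    have "parity_sign F (i * k) \<otimes> ?g x y z \<oplus> parity_sign F (j * i) \<otimes> ?g y z x \<oplus>
        parity_sign F (k * j) \<otimes> ?g z x y = \<zero>"
      using arg_cong[OF super_jacobi[OF even[OF x] even[OF y] even[OF z]], of \<sigma>] by simp
    \<comment> \<open>\<nu> need not preserve brackets; \<open>mult\<close> says that the failure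
      becomes invisible after one more bracket and \<sigma>.\<close>
    then show "parity_sign F (i * k) \<otimes>
          (\<lambda>(x, y)\<in>carrier G \<times> carrier G. ?f x y) (bracket G x y, z) \<oplus>
        parity_sign F (j * i) \<otimes>
          (\<lambda>(x, y)\<in>carrier G \<times> carrier G. ?f x y) (bracket G y z, x) \<oplus>
        parity_sign F (k * j) \<otimes>
          (\<lambda>(x, y)\<in>carrier G \<times> carrier G. ?f x y) (bracket G z x, y) = \<zero>"
      by (simp add: mult)
  qed auto
qed

text \<open>The sign in \<open>coboundaries2\<close> is absorbed by replacing \<sigma> with its
  negative.\<close>

lemma coboundary_iff:
  "f \<in> coboundaries2 F L \<longleftrightarrow> f \<in> extensional (carrier L \<times> carrier L) \<and>
    (\<exists>\<sigma>. linear_map F L K \<sigma> \<and>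
      (\<forall>x\<in>carrier L. \<forall>y\<in>carrier L. f (x, y) = \<sigma> (bracket L x y)))" (is "?l \<longleftrightarrow> ?r")
proof
  assume ?l
  then obtain \<sigma> where "linear_map F L K \<sigma>"
    "f = (\<lambda>(x, y)\<in>carrier L \<times> carrier L. \<ominus> \<sigma> (bracket L x y))"
    unfolding coboundaries2_def by blast
  then show ?r using linear_map_neg[of F L K \<sigma>] by (auto intro!: exI[of _ "\<lambda>x. \<ominus> \<sigma> x"])
next
  assume ?r
  then obtain \<sigma> where ext: "f \<in> extensional (carrier L \<times> carrier L)" and \<sigma>: "linear_map F L K \<sigma>"
    and f: "\<And>x y. \<lbrakk>x \<in> carrier L; y \<in> carrier L\<rbrakk> \<Longrightarrow> f (x, y) = \<sigma> (bracket L x y)" by blast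
  have "f = (\<lambda>(x, y)\<in>carrier L \<times> carrier L. \<ominus> (\<ominus> \<sigma> (bracket L x y)))"
    by (rule extensionalityI[OF ext restrict_extensional]) (auto simp: f functionalD[OF \<sigma>])
  then show ?l using linear_map_neg[OF \<sigma>] unfolding coboundaries2_def by auto
qed

lemma coboundary_cocycle: "coboundaries2 F L \<subseteq> cocycles2 F L"
proof
  fix f assume "f \<in> coboundaries2 F L"
  then obtain \<sigma> where ext: "f \<in> extensional (carrier L \<times> carrier L)" and \<sigma>: "linear_map F L K \<sigma>"
    and f: "\<And>x y. \<lbrakk>x \<in> carrier L; y \<in> carrier L\<rbrakk> \<Longrightarrow> f (x, y) = \<sigma> (bracket L x y)"
    unfolding coboundary_iff by blast
  have "linear_map F L L (\<lambda>x. x)" by (rule linear_mapI) (simp_all add: module_axioms)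
  \<comment> \<open>A coboundary is the pullback along the identity, for which \<open>mult\<close>
    is trivial.\<close>
  then have "(\<lambda>(x, y)\<in>carrier L \<times> carrier L. \<sigma> (bracket L x y)) \<in> cocycles2 F L"
    using pullback_cocycle[OF lie_superalgebra_axioms _ _ \<sigma>, of "\<lambda>x. x"] by simp
  moreover have "f = (\<lambda>(x, y)\<in>carrier L \<times> carrier L. \<sigma> (bracket L x y))"
    by (rule extensionalityI[OF ext restrict_extensional]) (auto simp: f)
  ultimately show "f \<in> cocycles2 F L" by simp
qed

section \<open>The quotient of cocycles by coboundaries\<close>

lemma coboundary_submodule: "submodule (coboundaries2 F L) F (cocycle_module F L)"
proof -
  interpret Z: module F "cocycle_module F L" by (rule module_cocycle_module)
  have smult: "(\<lambda>s\<in>carrier L \<times> carrier L. c \<otimes> f s) \<in> coboundaries2 F L"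
    if c: "c \<in> carrier F" and f: "f \<in> coboundaries2 F L" for c f
  proof -
    obtain \<sigma> where \<sigma>: "linear_map F L K \<sigma>"
      and f: "\<And>x y. \<lbrakk>x \<in> carrier L; y \<in> carrier L\<rbrakk> \<Longrightarrow> f (x, y) = \<sigma> (bracket L x y)"
      using f unfolding coboundary_iff by blast
    show ?thesis unfolding coboundary_iff using linear_map_scale[OF \<sigma> c] f by auto
  qed
  show ?thesis
  proof (rule Z.submoduleI)
    show "coboundaries2 F L \<subseteq> carrier (cocycle_module F L)" using coboundary_cocycle by simp
    show "\<zero>\<^bsub>cocycle_module F L\<^esub> \<in> coboundaries2 F L"
      unfolding coboundary_iff using linear_map_const_zero[OF module_axioms module_K] by auto
    show "c \<odot>\<^bsub>cocycle_module F L\<^esub> f \<in> coboundaries2 F L"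
      if "c \<in> carrier F" "f \<in> coboundaries2 F L" for c f
      using smult that by simp
    show "\<ominus>\<^bsub>cocycle_module F L\<^esub> f \<in> coboundaries2 F L" if f: "f \<in> coboundaries2 F L" for f
    proof -
      have f': "f \<in> carrier (cocycle_module F L)" using f coboundary_cocycle by auto
      \<comment> \<open>The inverse in the cocycle module is given abstractly; as a multiple by
        minus one it becomes pointwise.\<close>
      then have "\<ominus>\<^bsub>cocycle_module F L\<^esub> f = (\<ominus> \<one>) \<odot>\<^bsub>cocycle_module F L\<^esub> f"
        using Z.smult_l_minus[OF F.one_closed f'] Z.smult_one[OF f'] by argo
      then show ?thesis using smult[OF _ f, of "\<ominus> \<one>"] by simp
    qed
    fix f g assume f: "f \<in> coboundaries2 F L" and g: "g \<in> coboundaries2 F L"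
    obtain \<sigma> \<tau> where "linear_map F L K \<sigma>" "linear_map F L K \<tau>"
      "\<And>x y. \<lbrakk>x \<in> carrier L; y \<in> carrier L\<rbrakk> \<Longrightarrow> f (x, y) = \<sigma> (bracket L x y)"
      "\<And>x y. \<lbrakk>x \<in> carrier L; y \<in> carrier L\<rbrakk> \<Longrightarrow> g (x, y) = \<tau> (bracket L x y)"
      using f g unfolding coboundary_iff by blast
    then show "f \<oplus>\<^bsub>cocycle_module F L\<^esub> g \<in> coboundaries2 F L"
      unfolding coboundary_iff using linear_map_plus[of F L K \<sigma> \<tau>] by auto
  qed
qed

sublocale H2: quotient_by_submodule F "cocycle_module F L" "coboundaries2 F L"
  by (intro quotient_by_submodule.intro quotient_by_submodule_axioms.intro
      module_cocycle_module coboundary_submodule)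

lemma H2_class_linear: "linear_map F (cocycle_module F L) (H2 F L) (H2_class F L)"
  using H2.coset_linear_map unfolding H2_def H2_class_def[abs_def] .

lemma carrier_H2: "carrier (H2 F L) = H2_class F L ` cocycles2 F L"
  by (auto simp: H2_def H2_class_def quotient_module_def A_RCOSETS_def')

text \<open>Later comparisons of classes are reduced to equations between values in the field, with
  an explicit functional as witness and no subtraction of cocycles.\<close>

lemma H2_class_eq_iff:
  assumes f: "f \<in> cocycles2 F L" and g: "g \<in> cocycles2 F L"
  shows "H2_class F L f = H2_class F L g \<longleftrightarrow>
    (\<exists>\<sigma>. linear_map F L K \<sigma> \<and>
      (\<forall>x\<in>carrier L. \<forall>y\<in>carrier L. f (x, y) = g (x, y) \<oplus> \<sigma> (bracket L x y)))"
proof -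
  let ?h = "f \<ominus>\<^bsub>cocycle_module F L\<^esub> g"
  have f': "f \<in> carrier (cocycle_module F L)" and g': "g \<in> carrier (cocycle_module F L)"
    using f g by simp_all
  have h: "?h \<in> cocycles2 F L" using f g H2.M.minus_closed[of f g] by simp
  \<comment> \<open>Addition of cocycles is pointwise by definition, subtraction is not; hence the
    detour through \<open>f = ?h + g\<close>.\<close>
  have eq: "f = ?h \<oplus>\<^bsub>cocycle_module F L\<^esub> g"
    unfolding a_minus_def
    using f' g' by (metis H2.M.a_assoc H2.M.l_neg H2.M.a_inv_closed H2.M.r_zero)
  have pointwise: "?h (x, y) = s \<longleftrightarrow> f (x, y) = g (x, y) \<oplus> s"
    if xy: "x \<in> carrier L" "y \<in> carrier L" and s: "s \<in> carrier F" for x y s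
  proof -
    have "f (x, y) = ?h (x, y) \<oplus> g (x, y)"
      by (rule trans[OF fun_cong[OF eq]]) (simp add: xy)
    also have "\<dots> = g (x, y) \<oplus> ?h (x, y)"
      using cocycleD(5)[OF h xy] cocycleD(5)[OF g xy] by (rule F.a_comm)
    finally show ?thesis
      using F.r_neg1[OF cocycleD(5)[OF g xy] cocycleD(5)[OF h xy]] F.r_neg1[OF cocycleD(5)[OF g xy] s]
      by metis
  qed
  have "(\<forall>x\<in>carrier L. \<forall>y\<in>carrier L. ?h (x, y) = \<sigma> (bracket L x y)) \<longleftrightarrow>
      (\<forall>x\<in>carrier L. \<forall>y\<in>carrier L. f (x, y) = g (x, y) \<oplus> \<sigma> (bracket L x y))"
    if "linear_map F L K \<sigma>" for \<sigma>
    by (intro ball_cong refl pointwise) (simp_all add: functionalD(1)[OF that])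
  then show ?thesis
    unfolding H2_class_def H2.coset_eq_iff[OF f' g'] coboundary_iff
    using cocycleD(1)[OF h] by (simp cong: conj_cong)
qed

lemma H2_class_eq_zero_iff:
  assumes f: "f \<in> cocycles2 F L"
  shows "H2_class F L f = \<zero>\<^bsub>H2 F L\<^esub> \<longleftrightarrow>
    (\<exists>\<sigma>. linear_map F L K \<sigma> \<and> (\<forall>x\<in>carrier L. \<forall>y\<in>carrier L. f (x, y) = \<sigma> (bracket L x y)))"
proof -
  have zero: "(\<lambda>s\<in>carrier L \<times> carrier L. \<zero>) \<in> cocycles2 F L"
    using H2.M.zero_closed by simp
  have "\<zero>\<^bsub>H2 F L\<^esub> = H2_class F L (\<lambda>s\<in>carrier L \<times> carrier L. \<zero>)"
    using linear_map_zero[OF H2_class_linear] by simp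
  moreover have "\<zero> \<oplus> \<sigma> (bracket L x y) = \<sigma> (bracket L x y)"
    if "linear_map F L K \<sigma>" "x \<in> carrier L" "y \<in> carrier L" for \<sigma> x y
    using that functionalD(1)[OF that(1)] by simp
  ultimately show ?thesis
    by (simp add: H2_class_eq_iff[OF f zero] cong: conj_cong)
qed

end

section \<open>The quotient by a central subalgebra\<close>

lemma submodule_image:
  assumes p: "linear_map F A B p" and S: "submodule S F A"
  shows "submodule (p ` S) F B"
proof -
  interpret A: module F A using p by (rule linear_map_source)
  interpret B: module F B using p by (rule linear_map_target)
  note S' = A.submoduleE[OF S]
  have S_closed: "\<And>x. x \<in> S \<Longrightarrow> x \<in> carrier A" using S'(1) by blast
  show ?thesis
  proof (rule B.submoduleI)
    show "p ` S \<subseteq> carrier B" using S_closed linear_map_closed[OF p] by blast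
    have "\<zero>\<^bsub>A\<^esub> \<in> S" using S subgroup.one_closed unfolding submodule_def by force
    then show "\<zero>\<^bsub>B\<^esub> \<in> p ` S" using linear_map_zero[OF p] by force
  next
    fix u assume "u \<in> p ` S"
    then obtain x where x: "x \<in> S" "u = p x" by blast
    show "\<ominus>\<^bsub>B\<^esub> u \<in> p ` S"
      using x S'(3)[OF x(1)] linear_map_uminus[OF p S_closed[OF x(1)]] by (metis imageI)
    show "c \<odot>\<^bsub>B\<^esub> u \<in> p ` S" if c: "c \<in> carrier F" for c
      using x S'(4)[OF c x(1)] linear_map_smult[OF p c S_closed[OF x(1)]] by (metis imageI)
    fix v assume "v \<in> p ` S"
    then obtain y where y: "y \<in> S" "v = p y" by blast
    show "u \<oplus>\<^bsub>B\<^esub> v \<in> p ` S"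
      using x y S'(5)[OF x(1) y(1)] linear_map_add[OF p S_closed[OF x(1)] S_closed[OF y(1)]]
      by (metis imageI)
  qed
qed

locale central_extension = lie_cohomology F L
  for F :: "('f, 'm) ring_scheme" (structure) and L :: "('f, 'v) lie_superalgebra" (structure) +
  fixes H :: "'v set"
  assumes subalgebra: "lie_subalgebra F L H"
    and central: "H \<subseteq> lie_center L"
begin

abbreviation "Q \<equiv> lie_quotient L H"
abbreviation "\<pi> \<equiv> lie_proj L H"

sublocale coset: quotient_by_submodule F L H
  using subalgebra unfolding lie_subalgebra_def
  by (intro quotient_by_submodule.intro quotient_by_submodule_axioms.intro module_axioms) blast

lemma H_closed: "x \<in> H \<Longrightarrow> x \<in> carrier L"
  using submoduleE(1)[OF coset.submodule] by blast

text \<open>A graded subalgebra contains a homogeneous decomposition of each of its elements, and by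
  uniqueness that decomposition is the one in \<open>L\<close>.\<close>

lemma H_component: "x \<in> H \<Longrightarrow> component i x \<in> H"
proof -
  assume "x \<in> H"
  then have "x \<in> (H \<inter> part L 0) <+>\<^bsub>L\<^esub> (H \<inter> part L 1)"
    using subalgebra unfolding lie_subalgebra_def by blast
  then obtain a b where ab: "a \<in> H" "a \<in> part L 0" "b \<in> H" "b \<in> part L 1" "x = a \<oplus>\<^bsub>L\<^esub> b"
    unfolding set_add_def' by blast
  have "component 0 x = a" using component_add[of a 0 b] ab by simp
  moreover have "component 1 x = b"
    using component_add[of b 1 a] ab V.M.a_comm[of a b] by simp
  ultimately show ?thesis using ab by (cases i) simp_all
qed

lemma bracket_H_left: "\<lbrakk>h \<in> H; x \<in> carrier L\<rbrakk> \<Longrightarrow> bracket L h x = \<zero>\<^bsub>L\<^esub>"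
  using central unfolding lie_center_def by blast

text \<open>\<open>lie_center\<close> speaks of brackets with the central element on the left. Super
  skew symmetry swaps the sides only for homogeneous elements, so both \<open>x\<close> and
  \<open>h\<close> are split, the latter inside \<open>H\<close>.\<close>

lemma bracket_H_right:
  assumes h: "h \<in> H" and x: "x \<in> carrier L"
  shows "bracket L x h = \<zero>\<^bsub>L\<^esub>"
proof -
  have hom: "bracket L x h = \<zero>\<^bsub>L\<^esub>" if h: "h \<in> H" "h \<in> part L j" for h j
    using x
  proof (induction x rule: homogeneous_induct)
    case (homogeneous i x)
    have "bracket L x h = \<ominus>\<^bsub>L\<^esub> (parity_sign F (i * j) \<odot>\<^bsub>L\<^esub> bracket L h x)"
      using homogeneous h(2) by (rule super_skew)
    also have "bracket L h x = \<zero>\<^bsub>L\<^esub>" using homogeneous h by (intro bracket_H_left) auto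
    finally show ?case by simp
  next
    case (add x y)
    then show ?case using linear_map_add[OF bracket_linear_left[of h], of x y] h by simp
  qed
  have "bracket L x (component 0 h) = \<zero>\<^bsub>L\<^esub>" "bracket L x (component (0 + 1) h) = \<zero>\<^bsub>L\<^esub>"
    using h H_closed[OF h] by (auto intro!: hom H_component)
  then show ?thesis
    using linear_map_add[OF bracket_linear_right[OF x], of "component 0 h" "component (0 + 1) h"]
      component_sum[of h 0] H_closed[OF h] by simp
qed

section \<open>The Lie superalgebra structure of the quotient\<close>

lemma lie_quotient_simps:
  "carrier Q = carrier (quotient_module L H)" "add Q = add (quotient_module L H)"
  "zero Q = zero (quotient_module L H)" "smult Q = smult (quotient_module L H)"
  "part Q = (\<lambda>i. \<pi> ` part L i)"
  "bracket Q = (\<lambda>X Y. \<Union>x\<in>X. \<Union>y\<in>Y. \<pi> (bracket L x y))"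
  by (simp_all add: lie_quotient_def module.defs)

lemma carrier_quotient: "carrier Q = \<pi> ` carrier L"
  by (auto simp: lie_quotient_simps quotient_module_def A_RCOSETS_def' lie_proj_def)

lemma proj_linear: "linear_map F L Q \<pi>"
  by (rule linear_map_transport[OF coset.coset_linear_map[folded lie_proj_def]])
    (simp_all add: lie_quotient_simps)

lemma module_quotient: "module F Q"
  using proj_linear by (rule linear_map_target)

lemma proj_closed [simp, intro]: "x \<in> carrier L \<Longrightarrow> \<pi> x \<in> carrier Q"
  by (simp add: carrier_quotient)

lemma proj_eq_iff:
  "\<lbrakk>x \<in> carrier L; y \<in> carrier L\<rbrakk> \<Longrightarrow> \<pi> x = \<pi> y \<longleftrightarrow> x \<ominus>\<^bsub>L\<^esub> y \<in> H"
  unfolding lie_proj_def by (rule coset.coset_eq_iff)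

lemma proj_zero_iff: "x \<in> carrier L \<Longrightarrow> \<pi> x = \<zero>\<^bsub>Q\<^esub> \<longleftrightarrow> x \<in> H"
  using proj_eq_iff[of x "\<zero>\<^bsub>L\<^esub>"] linear_map_zero[OF proj_linear] by (simp add: V.M.minus_zero_right)

text \<open>The arguments are changed one at a time: \<open>x' - x\<close> and \<open>y' - y\<close>
  lie in \<open>H\<close>, so their brackets vanish. Since \<open>H\<close> is central and not
  merely an ideal, the equality holds in \<open>L\<close> itself.\<close>

lemma bracket_proj_cong:
  assumes "x \<in> carrier L" "y \<in> carrier L" "x' \<in> carrier L" "y' \<in> carrier L"
    and "\<pi> x' = \<pi> x" "\<pi> y' = \<pi> y"
  shows "bracket L x' y' = bracket L x y"
proof -
  have "x' \<ominus>\<^bsub>L\<^esub> x \<in> H" "y' \<ominus>\<^bsub>L\<^esub> y \<in> H" using assms proj_eq_iff by blast+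
  then have "bracket L x' y' \<ominus>\<^bsub>L\<^esub> bracket L x y' = \<zero>\<^bsub>L\<^esub>" "bracket L x y' \<ominus>\<^bsub>L\<^esub> bracket L x y = \<zero>\<^bsub>L\<^esub>"
    using assms linear_map_minus[OF bracket_linear_left[of y'], of x' x]
      linear_map_minus[OF bracket_linear_right[of x], of y' y]
      bracket_H_left[of "x' \<ominus>\<^bsub>L\<^esub> x" y'] bracket_H_right[of "y' \<ominus>\<^bsub>L\<^esub> y" x] by simp_all
  then show ?thesis using assms by (simp add: V.M.minus_eq_zero_iff)
qed

lemma mem_projD:
  assumes "x \<in> carrier L" "y \<in> \<pi> x" shows "y \<in> carrier L" "\<pi> y = \<pi> x"
  using assms coset.a_elemrcos_carrier coset.a_repr_independence' unfolding lie_proj_def by blast+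

lemma mem_proj_self: "x \<in> carrier L \<Longrightarrow> x \<in> \<pi> x"
  unfolding lie_proj_def by (rule coset.a_rcos_self)

lemma bracket_quotient:
  assumes x: "x \<in> carrier L" and y: "y \<in> carrier L"
  shows "bracket Q (\<pi> x) (\<pi> y) = \<pi> (bracket L x y)"
proof -
  have "bracket L x' y' = bracket L x y" if "x' \<in> \<pi> x" "y' \<in> \<pi> y" for x' y'
    using mem_projD[OF x that(1)] mem_projD[OF y that(2)] x y by (intro bracket_proj_cong) auto
  \<comment> \<open>The bracket of cosets is a union over representatives, and all its terms
    agree.\<close>
  then have "(\<Union>x'\<in>\<pi> x. \<Union>y'\<in>\<pi> y. \<pi> (bracket L x' y')) = (\<Union>x'\<in>\<pi> x. \<Union>y'\<in>\<pi> y. \<pi> (bracket L x y))"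
    by simp
  also have "\<dots> = \<pi> (bracket L x y)" using mem_proj_self[OF x] mem_proj_self[OF y] by blast
  finally show ?thesis by (simp add: lie_quotient_simps)
qed

lemma superspace_quotient: "superspace F Q"
proof (intro superspace.intro superspace_axioms.intro F.field_axioms module_quotient)
  show "submodule (part Q i) F Q" for i
    unfolding lie_quotient_simps(5) by (rule submodule_image[OF proj_linear part_submodule])
  show "part Q 0 \<inter> part Q 1 = {\<zero>\<^bsub>Q\<^esub>}"
  proof (intro equalityI subsetI)
    fix X assume "X \<in> part Q 0 \<inter> part Q 1"
    then obtain a b where a: "a \<in> part L 0" and b: "b \<in> part L 1" and X: "X = \<pi> a" "X = \<pi> b"
      by (auto simp: lie_quotient_simps)
    have ab: "a \<in> carrier L" "b \<in> carrier L" using a b by auto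
    \<comment> \<open>\<open>a - b\<close> lies in \<open>H\<close> and its component of degree 0 is
      \<open>a\<close>; as \<open>H\<close> is graded, \<open>a\<close> lies in \<open>H\<close> and
      its class is zero.\<close>
    have "component 0 (a \<ominus>\<^bsub>L\<^esub> b) = component 0 a \<ominus>\<^bsub>L\<^esub> component 0 b"
      using ab by (rule linear_map_minus[OF component_linear])
    also have "\<dots> = a" using component_same[OF a] component_other[of b 0] a b ab
      by (simp add: a_minus_def)
    finally have "a \<in> H" using H_component[of "a \<ominus>\<^bsub>L\<^esub> b" 0] X ab proj_eq_iff by metis
    then show "X \<in> {\<zero>\<^bsub>Q\<^esub>}" using X ab proj_zero_iff by simp
  next
    fix X assume "X \<in> {\<zero>\<^bsub>Q\<^esub>}"
    then have "X = \<pi> \<zero>\<^bsub>L\<^esub>" using linear_map_zero[OF proj_linear] by simp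
    then show "X \<in> part Q 0 \<inter> part Q 1" by (auto simp: lie_quotient_simps)
  qed
  have "part Q 0 <+>\<^bsub>Q\<^esub> part Q 1 = \<pi> ` (part L 0 <+>\<^bsub>L\<^esub> part L 1)"
  proof -
    have "\<pi> a \<oplus>\<^bsub>Q\<^esub> \<pi> b = \<pi> (a \<oplus>\<^bsub>L\<^esub> b)" if "a \<in> part L 0" "b \<in> part L 1" for a b
      using that linear_map_add[OF proj_linear, of a b] by simp
    then show ?thesis
      by (auto simp: set_add_def' lie_quotient_simps(5))
  qed
  then show "part Q 0 <+>\<^bsub>Q\<^esub> part Q 1 = carrier Q"
    by (simp add: part_sum carrier_quotient)
qed

lemma lie_superalgebra_quotient: "lie_superalgebra F Q"
proof (intro lie_superalgebra.intro lie_superalgebra_axioms.intro superspace_quotient)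
  note pi_simps = linear_map_add[OF proj_linear, symmetric] linear_map_smult[OF proj_linear, symmetric]
    linear_map_uminus[OF proj_linear, symmetric] linear_map_zero[OF proj_linear, symmetric]
    bracket_quotient
  show "bilinear_map F Q Q Q (bracket Q)"
    unfolding bilinear_map_def
  proof (intro conjI ballI)
    fix X assume "X \<in> carrier Q"
    then obtain x where x: "x \<in> carrier L" "X = \<pi> x" by (auto simp: carrier_quotient)
    show "linear_map F Q Q (bracket Q X)"
      by (rule linear_map_factor[OF proj_linear carrier_quotient
            linear_map_compose[OF bracket_linear_right[OF x(1)] proj_linear]])
        (simp add: x bracket_quotient)
    show "linear_map F Q Q (\<lambda>Y. bracket Q Y X)"
      by (rule linear_map_factor[OF proj_linear carrier_quotient
            linear_map_compose[OF bracket_linear_left[OF x(1)] proj_linear]])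
        (simp add: x bracket_quotient)
  qed
  fix X Y i j assume "X \<in> part Q i" and "Y \<in> part Q j"
  then obtain x y where x: "x \<in> part L i" "X = \<pi> x" and y: "y \<in> part L j" "Y = \<pi> y"
    by (auto simp: lie_quotient_simps(5))
  have [simp]: "x \<in> carrier L" "y \<in> carrier L" using x y by auto
  show "bracket Q X Y \<in> part Q (i + j)"
    using bracket_part[OF x(1) y(1)] by (simp add: x(2) y(2) bracket_quotient lie_quotient_simps(5))
  show "bracket Q X Y = \<ominus>\<^bsub>Q\<^esub> (parity_sign F (i * j) \<odot>\<^bsub>Q\<^esub> bracket Q Y X)"
    using arg_cong[OF super_skew[OF x(1) y(1)], of \<pi>] by (simp add: x(2) y(2) pi_simps)
  fix Z k assume "Z \<in> part Q k"
  then obtain z where z: "z \<in> part L k" "Z = \<pi> z" by (auto simp: lie_quotient_simps(5))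
  have [simp]: "z \<in> carrier L" using z by auto
  show "parity_sign F (i * k) \<odot>\<^bsub>Q\<^esub> bracket Q (bracket Q X Y) Z \<oplus>\<^bsub>Q\<^esub>
        parity_sign F (j * i) \<odot>\<^bsub>Q\<^esub> bracket Q (bracket Q Y Z) X \<oplus>\<^bsub>Q\<^esub>
        parity_sign F (k * j) \<odot>\<^bsub>Q\<^esub> bracket Q (bracket Q Z X) Y = \<zero>\<^bsub>Q\<^esub>"
    using arg_cong[OF super_jacobi[OF x(1) y(1) z(1)], of \<pi>]
    by (simp add: x(2) y(2) z(2) pi_simps)
qed

text \<open>Needed to apply \<open>hom_space_trivial\<close> to \<open>H\<close>, regarded as a
  module on its own.\<close>

lemma superspace_restrict: "superspace F (lie_restrict L H)"
proof -
  let ?H = "lie_restrict L H"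
  have simps: "carrier ?H = H" "add ?H = add L" "zero ?H = zero L" "smult ?H = smult L"
    "part ?H = (\<lambda>i. H \<inter> part L i)" by (simp_all add: lie_restrict_def)
  have H: "module F ?H"
    by (rule module_cong[OF submodule.submodule_is_module[OF coset.submodule module_axioms]])
      (simp_all add: simps)
  interpret H: module F ?H by (rule H)
  \<comment> \<open>Additive inverses are defined relative to the carrier, so those of
    \<open>H\<close> and of \<open>L\<close> have to be compared; both are multiples by minus
    one.\<close>
  have uminus: "\<ominus>\<^bsub>?H\<^esub> x = \<ominus>\<^bsub>L\<^esub> x" if "x \<in> H" for x
  proof -
    have "\<ominus>\<^bsub>?H\<^esub> x = (\<ominus>\<^bsub>F\<^esub> \<one>\<^bsub>F\<^esub>) \<odot>\<^bsub>L\<^esub> x"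
      using H.smult_l_minus[of "\<one>\<^bsub>F\<^esub>" x] H.smult_one[of x] that by (simp add: simps)
    also have "\<dots> = \<ominus>\<^bsub>L\<^esub> x" using that H_closed by (simp add: smult_l_minus)
    finally show ?thesis .
  qed
  show ?thesis
  proof (intro superspace.intro superspace_axioms.intro F.field_axioms H)
    show "submodule (part ?H i) F ?H" for i
      using submoduleE[OF coset.submodule] submoduleE[OF part_submodule[of i]]
      by (intro H.submoduleI) (auto simp: simps uminus coset.zero_closed)
    show "part ?H 0 \<inter> part ?H 1 = {\<zero>\<^bsub>?H\<^esub>}"
      using part_disjoint coset.zero_closed by (auto simp: simps)
    show "part ?H 0 <+>\<^bsub>?H\<^esub> part ?H 1 = carrier ?H"
      using subalgebra unfolding lie_subalgebra_def by (simp add: simps set_add_def')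
  qed
qed

sublocale quot: lie_cohomology F "lie_quotient L H"
  using lie_superalgebra_quotient by (rule lie_cohomology.intro)

text \<open>In each degree \<open>W i\<close> is a complement of the part of \<open>H\<close> in
  that degree. Their sum \<open>S\<close> is a graded complement of \<open>H\<close>, and inverting
  \<pi> on \<open>S\<close> gives an even section.\<close>

lemma section_exists: "lie_sections F L H \<noteq> {}"
proof -
  have "\<forall>i. \<exists>W. submodule W F L \<and> W \<subseteq> part L i \<and> (H \<inter> part L i) \<inter> W = {\<zero>\<^bsub>L\<^esub>} \<and>
      (\<forall>x\<in>part L i. \<exists>h\<in>H \<inter> part L i. \<exists>w\<in>W. x = h \<oplus>\<^bsub>L\<^esub> w)"
  proof
    fix i
    show "\<exists>W. submodule W F L \<and> W \<subseteq> part L i \<and> (H \<inter> part L i) \<inter> W = {\<zero>\<^bsub>L\<^esub>} \<and>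
      (\<forall>x\<in>part L i. \<exists>h\<in>H \<inter> part L i. \<exists>w\<in>W. x = h \<oplus>\<^bsub>L\<^esub> w)"
      using submodule_complement[OF F.field_axioms submodule_Int[OF coset.submodule part_submodule]
          part_submodule, of i i] by (metis inf_le2)
  qed
  from choice[OF this] obtain W where all: "\<forall>i. submodule (W i) F L \<and> W i \<subseteq> part L i \<and>
      (H \<inter> part L i) \<inter> W i = {\<zero>\<^bsub>L\<^esub>} \<and>
      (\<forall>x\<in>part L i. \<exists>h\<in>H \<inter> part L i. \<exists>w\<in>W i. x = h \<oplus>\<^bsub>L\<^esub> w)" ..
  have W: "submodule (W i) F L" and W_part: "\<And>w. w \<in> W i \<Longrightarrow> w \<in> part L i"
    and W_disjoint: "(H \<inter> part L i) \<inter> W i = {\<zero>\<^bsub>L\<^esub>}"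
    and W_sum: "\<And>x. x \<in> part L i \<Longrightarrow> \<exists>h\<in>H \<inter> part L i. \<exists>w\<in>W i. x = h \<oplus>\<^bsub>L\<^esub> w" for i
    using all[rule_format, of i] by auto
  have W_zero: "\<zero>\<^bsub>L\<^esub> \<in> W i" for i using W_disjoint[of i] by blast
  \<comment> \<open>The sum of \<open>W 0\<close> and \<open>W 1\<close>, described by components so
    that membership can be tested in each degree.\<close>
  define S where "S = {w \<in> carrier L. \<forall>i. component i w \<in> W i}"
  have S_closed: "w \<in> carrier L" if "w \<in> S" for w using that by (simp add: S_def)
  have S_add: "v \<oplus>\<^bsub>L\<^esub> w \<in> S" if "v \<in> S" "w \<in> S" for v w
    using that submoduleE(5)[OF W] by (auto simp: S_def linear_map_add[OF component_linear])
  have S_smult: "c \<odot>\<^bsub>L\<^esub> w \<in> S" if "c \<in> carrier F" "w \<in> S" for c w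
    using that submoduleE(4)[OF W] by (auto simp: S_def linear_map_smult[OF component_linear])
  have S_part: "w \<in> S" if "w \<in> W i" for w i
  proof -
    have "component j w \<in> W j" for j
    proof (cases "j = i")
      case True
      then show ?thesis using that component_same[OF W_part[OF that]] by simp
    next
      case False
      then have "w \<in> part L (j + 1)" using W_part[OF that] bit_parity_cases[of i j] by auto
      then show ?thesis using W_zero by (simp add: component_other)
    qed
    then show ?thesis using W_part[OF that] by (auto simp: S_def)
  qed
  \<comment> \<open>The components of \<open>v - w\<close> lie both in \<open>H\<close> and in some
    \<open>W i\<close>, hence vanish.\<close>
  have S_unique: "v = w" if v: "v \<in> S" and w: "w \<in> S" and eq: "\<pi> v = \<pi> w" for v w
  proof -
    have vw: "v \<in> carrier L" "w \<in> carrier L" using v w by (simp_all add: S_def)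
    have H: "v \<ominus>\<^bsub>L\<^esub> w \<in> H" using eq vw by (simp add: proj_eq_iff)
    have "component i v = component i w" for i
    proof -
      have diff: "component i (v \<ominus>\<^bsub>L\<^esub> w) = component i v \<ominus>\<^bsub>L\<^esub> component i w"
        using vw by (rule linear_map_minus[OF component_linear])
      moreover have "component i v \<ominus>\<^bsub>L\<^esub> component i w \<in> W i"
        using v w submoduleE(3,5)[OF W] unfolding a_minus_def S_def by blast
      moreover have "component i (v \<ominus>\<^bsub>L\<^esub> w) \<in> H \<inter> part L i"
        using H_component[OF H] vw by simp
      ultimately have "component i v \<ominus>\<^bsub>L\<^esub> component i w = \<zero>\<^bsub>L\<^esub>" using W_disjoint[of i] by auto
      then show ?thesis using vw by (simp add: V.M.minus_eq_zero_iff)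
    qed
    then show ?thesis using component_sum[of v 0] component_sum[of w 0] vw by metis
  qed
  have homogeneous_lift: "\<exists>w\<in>W i. \<pi> w = \<pi> x" if x: "x \<in> part L i" for i x
  proof -
    obtain h w where h: "h \<in> H" and w: "w \<in> W i" and eq: "x = h \<oplus>\<^bsub>L\<^esub> w" using W_sum[OF x] by blast
    have "w \<in> carrier L" "h \<in> carrier L" using S_closed[OF S_part[OF w]] H_closed[OF h] .
    moreover from this have "x \<ominus>\<^bsub>L\<^esub> w = h" by (simp add: eq a_minus_def V.M.a_assoc V.M.r_neg)
    ultimately have "\<pi> x = \<pi> w" using h eq by (simp add: proj_eq_iff)
    then show ?thesis using w by metis
  qed
  have lift: "\<exists>w\<in>S. \<pi> w = \<pi> x" if "x \<in> carrier L" for x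
    using that
  proof (induction x rule: homogeneous_induct)
    case (homogeneous i x)
    then show ?case using homogeneous_lift S_part by blast
  next
    case (add x y)
    then obtain v w where "v \<in> S" "w \<in> S" "\<pi> v = \<pi> x" "\<pi> w = \<pi> y" by blast
    then show ?case
      using add.hyps S_add linear_map_add[OF proj_linear] S_closed by metis
  qed
  define \<mu> where "\<mu> X = (THE w. w \<in> S \<and> \<pi> w = X)" for X
  have \<mu>_eq: "\<mu> X = w" if "w \<in> S" "\<pi> w = X" for w X
    unfolding \<mu>_def
  proof (rule the_equality)
    show "w \<in> S \<and> \<pi> w = X" using that by blast
    show "v = w" if "v \<in> S \<and> \<pi> v = X" for v
      using that \<open>w \<in> S\<close> \<open>\<pi> w = X\<close> by (intro S_unique) auto
  qed
  have \<mu>: "\<mu> X \<in> S" "\<pi> (\<mu> X) = X" if "X \<in> carrier Q" for X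
  proof -
    obtain x where "x \<in> carrier L" "X = \<pi> x" using \<open>X \<in> carrier Q\<close> by (auto simp: carrier_quotient)
    then obtain w where w: "w \<in> S" "\<pi> w = X" using lift by metis
    then show "\<mu> X \<in> S" "\<pi> (\<mu> X) = X" using \<mu>_eq[OF w] by simp_all
  qed
  have "linear_map F Q L \<mu>"
  \<comment> \<open>Sums and multiples of lifts in \<open>S\<close> are again lifts in
    \<open>S\<close>, so uniqueness of the lift gives linearity.\<close>
  proof (rule linear_mapI[OF module_quotient module_axioms])
    show "\<mu> X \<in> carrier L" if "X \<in> carrier Q" for X using S_closed[OF \<mu>(1)[OF that]] .
    show "\<mu> (X \<oplus>\<^bsub>Q\<^esub> Y) = \<mu> X \<oplus>\<^bsub>L\<^esub> \<mu> Y" if "X \<in> carrier Q" "Y \<in> carrier Q" for X Y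
      by (rule \<mu>_eq) (use that \<mu> S_closed S_add in \<open>auto simp: linear_map_add[OF proj_linear]\<close>)
    show "\<mu> (c \<odot>\<^bsub>Q\<^esub> X) = c \<odot>\<^bsub>L\<^esub> \<mu> X" if "c \<in> carrier F" "X \<in> carrier Q" for c X
      by (rule \<mu>_eq) (use that \<mu> S_closed S_smult in \<open>auto simp: linear_map_smult[OF proj_linear]\<close>)
  qed
  \<comment> \<open>A homogeneous class has a lift in \<open>W i\<close>, and by uniqueness this is
    the value of \<mu>.\<close>
  moreover have "\<mu> X \<in> part L i" if X: "X \<in> part Q i" for X i
  proof -
    obtain x where "x \<in> part L i" "X = \<pi> x" using X by (auto simp: lie_quotient_simps(5))
    then obtain w where "w \<in> W i" "\<pi> w = X" using homogeneous_lift by blast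
    then show ?thesis using \<mu>_eq[OF S_part] W_part by metis
  qed
  ultimately have "\<mu> \<in> lie_sections F L H" using \<mu>(2) unfolding lie_sections_def by blast
  then show ?thesis by blast
qed

section \<open>The three Hom spaces as spaces of functionals\<close>

abbreviation "R \<equiv> lie_restrict L H"

lemma lie_restrict_simps [simp]:
  "carrier R = H" "add R = add L" "zero R = zero L" "smult R = smult L"
  "part R = (\<lambda>i. H \<inter> part L i)"
  by (simp_all add: lie_restrict_def)

lemma module_restrict: "module F R"
  using superspace_restrict by (simp add: superspace_def)

lemma inclusion_linear: "linear_map F R L (\<lambda>x. x)"
  by (rule linear_mapI[OF module_restrict module_axioms]) (simp_all add: H_closed)

lemma linear_map_into_restrict:
  assumes "linear_map F A L f" "\<And>x. x \<in> carrier A \<Longrightarrow> f x \<in> H"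
  shows "linear_map F A R f"
  by (rule linear_mapI[OF linear_map_source[OF assms(1)] module_restrict])
    (simp_all add: assms(2) linear_mapD[OF assms(1)])

text \<open>The bare set of brackets rather than its span: a functional vanishes on one exactly if
  it vanishes on the other.\<close>

definition derived where "derived = {bracket L x y | x y. x \<in> carrier L \<and> y \<in> carrier L}"

lemma bracket_derived: "\<lbrakk>x \<in> carrier L; y \<in> carrier L\<rbrakk> \<Longrightarrow> bracket L x y \<in> derived"
  unfolding derived_def by blast

abbreviation "Hom_Q \<equiv> functional_module F Q (\<pi> ` derived)"
abbreviation "Hom_L \<equiv> functional_module F L derived"
abbreviation "Hom_H \<equiv> functional_module F R {}"

text \<open>Equivariance is tested on homogeneous \<open>x\<close> only; linearity of the bracket in
  \<open>x\<close> extends it to all of \<open>L\<close>.\<close>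

lemma vanish_on_derived:
  assumes f: "linear_map F L K f"
  shows "(\<forall>v\<in>derived. f v = \<zero>) \<longleftrightarrow> (\<forall>i. \<forall>x\<in>part L i. \<forall>y\<in>carrier L. f (bracket L x y) = \<zero>)"
proof (intro iffI ballI)
  fix v assume hom: "\<forall>i. \<forall>x\<in>part L i. \<forall>y\<in>carrier L. f (bracket L x y) = \<zero>" and "v \<in> derived"
  then obtain x y where x: "x \<in> carrier L" and y: "y \<in> carrier L" and v: "v = bracket L x y"
    unfolding derived_def by blast
  have "f (bracket L x y) = \<zero>"
    using x
  proof (induction x rule: homogeneous_induct)
    case (homogeneous i x)
    then show ?case using hom y by blast
  next
    case (add a b)
    then show ?case
      using linear_map_add[OF bracket_linear_left[OF y]] functionalD(2)[OF f] y by simp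
  qed
  then show "f v = \<zero>" using v by simp
qed (auto simp: derived_def)

lemma hom_space_adjoint:
  "hom_space F L (adjoint_module L) (trivial_module F) = Hom_L"
  unfolding adjoint_module_def
  by (rule hom_space_trivial[OF _ bracket_part vanish_on_derived])
    (blast intro: bracket_linear_right part_in_carrier)

lemma hom_space_quotient:
  "hom_space F L (adjoint_quotient L H) (trivial_module F) = Hom_Q"
  unfolding adjoint_quotient_def
proof (rule quot.hom_space_trivial)
  show "linear_map F Q Q (bracket Q (\<pi> x))" if "x \<in> part L i" for i x
    using that by (intro quot.bracket_linear_right) auto
  show "bracket Q (\<pi> x) v \<in> part Q (i + j)" if "x \<in> part L i" "v \<in> part Q j" for i j x v
    using that by (intro quot.bracket_part) (auto simp: lie_quotient_simps(5))
  fix f assume f: "linear_map F Q K f"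
  \<comment> \<open>\<open>L\<close> acts on the quotient through \<pi>, so the condition is that of
    \<open>f \<circ> \<pi>\<close> on \<open>L\<close>.\<close>
  have "(\<forall>v\<in>\<pi> ` derived. f v = \<zero>) \<longleftrightarrow>
      (\<forall>i. \<forall>x\<in>part L i. \<forall>y\<in>carrier L. f (\<pi> (bracket L x y)) = \<zero>)"
    using vanish_on_derived[OF linear_map_compose[OF proj_linear f]] by simp
  also have "\<dots> \<longleftrightarrow> (\<forall>i. \<forall>x\<in>part L i. \<forall>v\<in>carrier Q. f (bracket Q (\<pi> x) v) = \<zero>)"
    using part_in_carrier by (simp add: carrier_quotient bracket_quotient)
  finally show "(\<forall>v\<in>\<pi> ` derived. f v = \<zero>) \<longleftrightarrow>
      (\<forall>i. \<forall>x\<in>part L i. \<forall>v\<in>carrier Q. f (bracket Q (\<pi> x) v) = \<zero>)" .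
qed

text \<open>\<open>L\<close> acts on the central \<open>H\<close> by zero, so equivariance imposes
  no condition and the set \<open>D\<close> is empty.\<close>

lemma hom_space_sub:
  "hom_space F L (adjoint_sub L H) (trivial_module F) = Hom_H"
  unfolding adjoint_sub_def
proof (rule superspace.hom_space_trivial[OF superspace_restrict])
  show "linear_map F R R (bracket L x)" if "x \<in> part L i" for i x
    by (rule linear_map_cong[OF linear_map_const_zero[OF module_restrict module_restrict]])
      (use that in \<open>auto simp: bracket_H_right\<close>)
  show "bracket L x v \<in> part R (i + j)" if "x \<in> part L i" "v \<in> part R j" for i j x v
    using that by (auto simp: bracket_H_right coset.zero_closed)
  show "(\<forall>v\<in>{}. f v = \<zero>) \<longleftrightarrow> (\<forall>i. \<forall>x\<in>part L i. \<forall>v\<in>carrier R. f (bracket L x v) = \<zero>)"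
    if "linear_map F R K f" for f
    using linear_map_zero[OF that] by (auto simp: bracket_H_right)
qed

lemma derived_closed: "derived \<subseteq> carrier L"
  by (auto simp: derived_def)

lemma module_Hom_L: "module F Hom_L"
  by (rule module_functional_module[OF derived_closed])

lemma module_Hom_Q: "module F Hom_Q"
  using derived_closed by (intro quot.module_functional_module) auto

lemma module_Hom_H: "module F Hom_H"
  by (rule module.module_functional_module[OF module_restrict]) simp

section \<open>Sections and transgression\<close>

text \<open>For a section \<mu>, the linear projection of \<open>L\<close> onto \<open>H\<close>
  along the image of \<mu>.\<close>

definition lift_defect :: "('v set \<Rightarrow> 'v) \<Rightarrow> 'v \<Rightarrow> 'v" where
  "lift_defect \<mu> x = x \<ominus>\<^bsub>L\<^esub> \<mu> (\<pi> x)"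

definition tra_cochain :: "('v set \<Rightarrow> 'v) \<Rightarrow> ('v \<Rightarrow> 'f) \<Rightarrow> 'v set \<times> 'v set \<Rightarrow> 'f" where
  "tra_cochain \<mu> \<alpha> = compose (carrier Q \<times> carrier Q) \<alpha> (factor_set L H \<mu>)"

lemma sectionD:
  assumes "\<mu> \<in> lie_sections F L H"
  shows section_linear: "linear_map F Q L \<mu>"
    and section_part: "\<And>i X. X \<in> part Q i \<Longrightarrow> \<mu> X \<in> part L i"
    and proj_section: "\<And>X. X \<in> carrier Q \<Longrightarrow> \<pi> (\<mu> X) = X"
    and section_closed: "\<And>X. X \<in> carrier Q \<Longrightarrow> \<mu> X \<in> carrier L"
proof -
  show \<mu>: "linear_map F Q L \<mu>" using assms unfolding lie_sections_def by blast
  show "\<mu> X \<in> part L i" if "X \<in> part Q i" for i X using assms that unfolding lie_sections_def by blast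
  show "\<pi> (\<mu> X) = X" if "X \<in> carrier Q" for X using assms that unfolding lie_sections_def by blast
  show "\<mu> X \<in> carrier L" if "X \<in> carrier Q" for X using linear_map_closed[OF \<mu> that] .
qed

lemma linear_map_id: "linear_map F L L (\<lambda>x. x)"
  by (rule linear_mapI[OF module_axioms module_axioms]) simp_all

lemma lift_defect_H:
  assumes "\<mu> \<in> lie_sections F L H" "x \<in> carrier L"
  shows "lift_defect \<mu> x \<in> H"
  using assms proj_eq_iff[of x "\<mu> (\<pi> x)"] unfolding lift_defect_def
  by (simp add: section_closed proj_section)

lemma lift_defect_linear:
  assumes "\<mu> \<in> lie_sections F L H"
  shows "linear_map F L R (lift_defect \<mu>)"
proof (rule linear_map_into_restrict)
  show "linear_map F L L (lift_defect \<mu>)"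
    unfolding lift_defect_def
    by (rule linear_map_diff[OF linear_map_id linear_map_compose[OF proj_linear section_linear[OF assms]]])
qed (rule lift_defect_H[OF assms])

lemma lift_defect_id:
  assumes "\<mu> \<in> lie_sections F L H" "h \<in> H"
  shows "lift_defect \<mu> h = h"
  using assms H_closed[of h] proj_zero_iff[of h] linear_map_zero[OF section_linear[OF assms(1)]]
  by (simp add: lift_defect_def V.M.minus_zero_right)

lemma bracket_section:
  assumes "\<mu> \<in> lie_sections F L H" "x \<in> carrier L" "y \<in> carrier L"
  shows "bracket L (\<mu> (\<pi> x)) (\<mu> (\<pi> y)) = bracket L x y"
  using assms by (intro bracket_proj_cong) (simp_all add: section_closed proj_section)

text \<open>Since \<open>[X, Y]\<close> is the class of \<open>[\<mu> X, \<mu> Y]\<close>, the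
  factor set is the defect of that bracket. This puts the cochain into the form required by
  \<open>pullback_cocycle\<close>.\<close>

lemma tra_cochain_eq:
  assumes \<mu>: "\<mu> \<in> lie_sections F L H" and "X \<in> carrier Q" "Y \<in> carrier Q"
  shows "tra_cochain \<mu> \<alpha> (X, Y) = \<alpha> (lift_defect \<mu> (bracket L (\<mu> X) (\<mu> Y)))"
proof -
  have "bracket Q X Y = \<pi> (bracket L (\<mu> X) (\<mu> Y))"
    using assms bracket_quotient[of "\<mu> X" "\<mu> Y"] by (simp add: section_closed proj_section)
  then show ?thesis
    using assms by (simp add: tra_cochain_def compose_def factor_set_def lift_defect_def)
qed

lemma tra_cochain_proj:
  assumes "\<mu> \<in> lie_sections F L H" "x \<in> carrier L" "y \<in> carrier L"
  shows "tra_cochain \<mu> \<alpha> (\<pi> x, \<pi> y) = \<alpha> (lift_defect \<mu> (bracket L x y))"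
  using assms by (simp add: tra_cochain_eq bracket_section)

lemma tra_cochain_cocycle:
  assumes \<mu>: "\<mu> \<in> lie_sections F L H" and \<alpha>: "linear_map F R K \<alpha>"
  shows "tra_cochain \<mu> \<alpha> \<in> cocycles2 F Q"
proof -
  have "(\<lambda>(X, Y)\<in>carrier Q \<times> carrier Q. \<alpha> (lift_defect \<mu> (bracket L (\<mu> X) (\<mu> Y)))) \<in> cocycles2 F Q"
  proof (rule pullback_cocycle[OF lie_superalgebra_quotient section_linear[OF \<mu>] section_part[OF \<mu>]
        linear_map_compose[OF lift_defect_linear[OF \<mu>] \<alpha>]])
    fix X Y Z assume X: "X \<in> carrier Q" and Y: "Y \<in> carrier Q" and Z: "Z \<in> carrier Q"
    \<comment> \<open>\<mu> is not multiplicative, but \<open>\<mu> [X, Y]\<close> and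
      \<open>[\<mu> X, \<mu> Y]\<close> agree modulo \<open>H\<close>, which a further bracket does
      not see.\<close>
    then have "bracket L (\<mu> (bracket Q X Y)) (\<mu> Z) = bracket L (bracket L (\<mu> X) (\<mu> Y)) (\<mu> Z)"
      using \<mu> bracket_quotient[of "\<mu> X" "\<mu> Y"]
      by (intro bracket_proj_cong) (simp_all add: section_closed proj_section)
    then show "\<alpha> (lift_defect \<mu> (bracket L (\<mu> (bracket Q X Y)) (\<mu> Z))) =
        \<alpha> (lift_defect \<mu> (bracket L (bracket L (\<mu> X) (\<mu> Y)) (\<mu> Z)))" by simp
  qed
  also have "(\<lambda>(X, Y)\<in>carrier Q \<times> carrier Q. \<alpha> (lift_defect \<mu> (bracket L (\<mu> X) (\<mu> Y)))) =
      tra_cochain \<mu> \<alpha>"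
    by (rule extensionalityI[OF restrict_extensional])
      (auto simp: tra_cochain_eq[OF \<mu>], simp add: tra_cochain_def)
  finally show ?thesis .
qed

lemma tra_cochain_class_unique:
  assumes \<mu>: "\<mu> \<in> lie_sections F L H" and \<mu>': "\<mu>' \<in> lie_sections F L H"
    and \<alpha>: "linear_map F R K \<alpha>"
  shows "H2_class F Q (tra_cochain \<mu>' \<alpha>) = H2_class F Q (tra_cochain \<mu> \<alpha>)"
  unfolding quot.H2_class_eq_iff[OF tra_cochain_cocycle[OF \<mu>' \<alpha>] tra_cochain_cocycle[OF \<mu> \<alpha>]]
proof (intro exI conjI ballI)
  \<comment> \<open>Two sections differ by a linear map into \<open>H\<close>; composed with
    \<alpha> it yields the functional whose coboundary separates the two cocycles.\<close>
  let ?\<delta> = "\<lambda>X. \<mu> X \<ominus>\<^bsub>L\<^esub> \<mu>' X"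
  have \<delta>: "linear_map F Q R ?\<delta>"
    using \<mu> \<mu>' proj_eq_iff
    by (intro linear_map_into_restrict linear_map_diff section_linear)
      (simp_all add: section_closed proj_section flip: proj_eq_iff)
  then show "linear_map F Q K (\<lambda>X. \<alpha> (?\<delta> X))" using \<alpha> by (rule linear_map_compose)
  fix X Y assume "X \<in> carrier Q" "Y \<in> carrier Q"
  then obtain x y where x: "x \<in> carrier L" "X = \<pi> x" and y: "y \<in> carrier L" "Y = \<pi> y"
    by (auto simp: carrier_quotient)
  let ?b = "bracket L x y"
  have b: "?b \<in> carrier L" using x y by simp
  have [simp]: "\<mu> (\<pi> ?b) \<in> carrier L" "\<mu>' (\<pi> ?b) \<in> carrier L"
    using \<mu> \<mu>' b by (simp_all add: section_closed)
  have "lift_defect \<mu>' ?b = lift_defect \<mu> ?b \<oplus>\<^bsub>L\<^esub> ?\<delta> (\<pi> ?b)"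
    unfolding lift_defect_def using b
    by (simp add: a_minus_def V.M.a_assoc V.M.r_neg1)
  then have "\<alpha> (lift_defect \<mu>' ?b) = \<alpha> (lift_defect \<mu> ?b) \<oplus> \<alpha> (?\<delta> (\<pi> ?b))"
    using linear_map_add[OF \<alpha>, of "lift_defect \<mu> ?b" "?\<delta> (\<pi> ?b)"]
      lift_defect_H[OF \<mu> b] linear_map_closed[OF \<delta>, of "\<pi> ?b"] b by simp
  then show "tra_cochain \<mu>' \<alpha> (X, Y) = tra_cochain \<mu> \<alpha> (X, Y) \<oplus> \<alpha> (?\<delta> (bracket Q X Y))"
    using x y \<mu> \<mu>' by (simp add: tra_cochain_proj bracket_quotient)
qed

text \<open>By the preceding independence the values at all sections form a singleton, so any one
  section computes the transgression.\<close>

lemma tra_eq: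
  assumes \<mu>: "\<mu> \<in> lie_sections F L H" and \<alpha>: "linear_map F R K \<alpha>"
  shows "tra F L H \<alpha> = H2_class F Q (tra_cochain \<mu> \<alpha>)"
proof -
  have "(\<lambda>\<mu>. H2_class F Q (tra_cochain \<mu> \<alpha>)) ` lie_sections F L H = {H2_class F Q (tra_cochain \<mu> \<alpha>)}"
    using \<mu> tra_cochain_class_unique[OF \<mu> _ \<alpha>] by blast
  then show ?thesis unfolding tra_def tra_cochain_def by simp
qed

text \<open>With one section fixed for all \<alpha>, linearity already holds at the level of
  cocycles.\<close>

lemma tra_linear: "linear_map F Hom_H (H2 F Q) (tra F L H)"
proof -
  obtain \<mu> where \<mu>: "\<mu> \<in> lie_sections F L H" using section_exists by blast
  have "linear_map F Hom_H (cocycle_module F Q) (tra_cochain \<mu>)"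
  proof (rule linear_mapI[OF module_Hom_H quot.module_cocycle_module])
    fix \<alpha> assume \<alpha>: "\<alpha> \<in> carrier Hom_H"
    then have \<alpha>_lin: "linear_map F R K \<alpha>" by simp
    show "tra_cochain \<mu> \<alpha> \<in> carrier (cocycle_module F Q)"
      using tra_cochain_cocycle[OF \<mu> \<alpha>_lin] by simp
    show "tra_cochain \<mu> (c \<odot>\<^bsub>Hom_H\<^esub> \<alpha>) = c \<odot>\<^bsub>cocycle_module F Q\<^esub> tra_cochain \<mu> \<alpha>" for c
      by (rule extensionalityI[where A = "carrier Q \<times> carrier Q"])
        (auto simp: tra_cochain_eq[OF \<mu>] lift_defect_H[OF \<mu>] section_closed[OF \<mu>],
         simp add: tra_cochain_def)
    fix \<beta> assume "\<beta> \<in> carrier Hom_H"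
    show "tra_cochain \<mu> (\<alpha> \<oplus>\<^bsub>Hom_H\<^esub> \<beta>) = tra_cochain \<mu> \<alpha> \<oplus>\<^bsub>cocycle_module F Q\<^esub> tra_cochain \<mu> \<beta>"
      by (rule extensionalityI[where A = "carrier Q \<times> carrier Q"])
        (auto simp: tra_cochain_eq[OF \<mu>] lift_defect_H[OF \<mu>] section_closed[OF \<mu>],
         simp add: tra_cochain_def)
  qed
  then show ?thesis
    by (rule linear_map_cong[OF linear_map_compose[OF _ quot.H2_class_linear]])
      (simp add: tra_eq[OF \<mu>])
qed

section \<open>Inflation on second cohomology\<close>

definition inf_cochain :: "('v set \<times> 'v set \<Rightarrow> 'f) \<Rightarrow> 'v \<times> 'v \<Rightarrow> 'f" where
  "inf_cochain \<beta> = (\<lambda>(x, y)\<in>carrier L \<times> carrier L. \<beta> (\<pi> x, \<pi> y))"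

lemma inf_cochain_eq [simp]:
  "\<lbrakk>x \<in> carrier L; y \<in> carrier L\<rbrakk> \<Longrightarrow> inf_cochain \<beta> (x, y) = \<beta> (\<pi> x, \<pi> y)"
  by (simp add: inf_cochain_def)

lemma inf_cochain_cocycle:
  assumes "\<beta> \<in> cocycles2 F Q"
  shows "inf_cochain \<beta> \<in> cocycles2 F L"
proof (rule cocycleI)
  note \<beta> = quot.cocycleD[OF assms]
  have proj_part: "\<pi> x \<in> part Q i" if "x \<in> part L i" for x i
    using that by (auto simp: lie_quotient_simps(5))
  show "inf_cochain \<beta> \<in> extensional (carrier L \<times> carrier L)" by (simp add: inf_cochain_def)
  have "linear_map F K K (\<lambda>x. x)" by (rule linear_mapI[OF module_K module_K]) simp_all
  then show "bilinear_map F L L K (\<lambda>x y. inf_cochain \<beta> (x, y))"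
    by (rule bilinear_map_cong[OF bilinear_map_compose[OF \<beta>(2) proj_linear]]) simp
  fix i j x y assume x: "x \<in> part L i" and y: "y \<in> part L j"
  have [simp]: "x \<in> carrier L" "y \<in> carrier L" using x y by auto
  show "inf_cochain \<beta> (x, y) = \<ominus> (parity_sign F (i * j) \<otimes> inf_cochain \<beta> (y, x))"
    using \<beta>(3)[OF proj_part[OF x] proj_part[OF y]] by simp
  fix k z assume z: "z \<in> part L k"
  have [simp]: "z \<in> carrier L" using z by auto
  show "parity_sign F (i * k) \<otimes> inf_cochain \<beta> (bracket L x y, z) \<oplus>
      parity_sign F (j * i) \<otimes> inf_cochain \<beta> (bracket L y z, x) \<oplus>
      parity_sign F (k * j) \<otimes> inf_cochain \<beta> (bracket L z x, y) = \<zero>"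
    using \<beta>(4)[OF proj_part[OF x] proj_part[OF y] proj_part[OF z]] by (simp add: bracket_quotient)
qed

lemma inf_cochain_class_cong:
  assumes \<beta>: "\<beta> \<in> cocycles2 F Q" and \<gamma>: "\<gamma> \<in> cocycles2 F Q"
    and eq: "H2_class F Q \<beta> = H2_class F Q \<gamma>"
  shows "H2_class F L (inf_cochain \<beta>) = H2_class F L (inf_cochain \<gamma>)"
proof -
  obtain \<sigma> where \<sigma>: "linear_map F Q K \<sigma>"
    and *: "\<And>X Y. \<lbrakk>X \<in> carrier Q; Y \<in> carrier Q\<rbrakk> \<Longrightarrow> \<beta> (X, Y) = \<gamma> (X, Y) \<oplus> \<sigma> (bracket Q X Y)"
    using eq unfolding quot.H2_class_eq_iff[OF \<beta> \<gamma>] by blast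
  \<comment> \<open>A coboundary on the quotient inflates to a coboundary, with its functional
    pulled back along \<pi>.\<close>
  have "linear_map F L K (\<lambda>x. \<sigma> (\<pi> x))" using proj_linear \<sigma> by (rule linear_map_compose)
  moreover have "inf_cochain \<beta> (x, y) = inf_cochain \<gamma> (x, y) \<oplus> \<sigma> (\<pi> (bracket L x y))"
    if "x \<in> carrier L" "y \<in> carrier L" for x y
    using that *[of "\<pi> x" "\<pi> y"] by (simp add: bracket_quotient)
  ultimately show ?thesis
    unfolding H2_class_eq_iff[OF inf_cochain_cocycle[OF \<beta>] inf_cochain_cocycle[OF \<gamma>]] by blast
qed

text \<open>All members of the coset are cocycles of the same class, so the set of inflated classes
  is a singleton.\<close>

lemma inf_H2_class:
  assumes \<beta>: "\<beta> \<in> cocycles2 F Q"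
  shows "inf_H2 F L H (H2_class F Q \<beta>) = H2_class F L (inf_cochain \<beta>)"
proof -
  have \<beta>': "\<beta> \<in> carrier (cocycle_module F Q)" using \<beta> by simp
  have "H2_class F L (inf_cochain \<gamma>) = H2_class F L (inf_cochain \<beta>)" if "\<gamma> \<in> H2_class F Q \<beta>" for \<gamma>
  proof -
    have "\<gamma> \<in> cocycles2 F Q" "H2_class F Q \<gamma> = H2_class F Q \<beta>"
      using that quot.H2.a_elemrcos_carrier[OF \<beta>'] quot.H2.a_repr_independence'[OF _ \<beta>']
      by (simp_all add: H2_class_def)
    then show ?thesis using \<beta> by (intro inf_cochain_class_cong)
  qed
  moreover have "\<beta> \<in> H2_class F Q \<beta>"
    using quot.H2.a_rcos_self[OF \<beta>'] by (simp add: H2_class_def)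
  ultimately have "(\<lambda>\<gamma>. H2_class F L (inf_cochain \<gamma>)) ` H2_class F Q \<beta> = {H2_class F L (inf_cochain \<beta>)}"
    by blast
  then show ?thesis unfolding inf_H2_def inf_cochain_def by simp
qed

lemma inf_H2_linear: "linear_map F (H2 F Q) (H2 F L) (inf_H2 F L H)"
proof (rule linear_map_factor[OF quot.H2_class_linear])
  show "carrier (H2 F Q) = H2_class F Q ` carrier (cocycle_module F Q)"
    by (simp add: quot.carrier_H2)
  have "linear_map F (cocycle_module F Q) (cocycle_module F L) inf_cochain"
    by (rule linear_mapI[OF quot.module_cocycle_module module_cocycle_module])
      (auto simp: inf_cochain_def intro!: restrict_ext inf_cochain_cocycle[unfolded inf_cochain_def])
  then show "linear_map F (cocycle_module F Q) (H2 F L) (\<lambda>\<beta>. H2_class F L (inf_cochain \<beta>))"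
    using H2_class_linear by (rule linear_map_compose)
qed (simp add: inf_H2_class)

section \<open>Exactness\<close>

lemma inf_hom_eq [simp]: "x \<in> carrier L \<Longrightarrow> inf_hom L H f x = f (\<pi> x)"
  by (simp add: inf_hom_def compose_def)

lemma inf_hom_linear: "linear_map F Hom_Q Hom_L (inf_hom L H)"
proof (rule linear_mapI[OF module_Hom_Q module_Hom_L])
  fix f assume f: "f \<in> carrier Hom_Q"
  have "linear_map F L K (inf_hom L H f)"
    by (rule linear_map_cong[OF linear_map_compose[OF proj_linear]]) (use f in simp_all)
  then show "inf_hom L H f \<in> carrier Hom_L"
    using f derived_closed by (auto simp: inf_hom_def compose_def)
qed (auto simp: inf_hom_def compose_def intro!: restrict_ext)

lemma res_hom_linear: "linear_map F Hom_L Hom_H (res_hom H)"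
proof (rule linear_mapI[OF module_Hom_L module_Hom_H])
  fix g assume g: "g \<in> carrier Hom_L"
  have "linear_map F R K (res_hom H g)"
    by (rule linear_map_cong[OF linear_map_compose[OF inclusion_linear, of K g]])
      (use g in \<open>simp_all add: res_hom_def\<close>)
  then show "res_hom H g \<in> carrier Hom_H" by (simp add: res_hom_def)
qed (auto simp: res_hom_def H_closed intro!: restrict_ext)

text \<open>This amounts to injectivity of inflation, which holds because \<pi> is onto.\<close>

lemma exact_at_Hom_Q:
  "exact_at F zero_module (\<lambda>_. \<zero>\<^bsub>Hom_Q\<^esub>) Hom_Q (inf_hom L H) Hom_L"
proof (rule exact_atI[OF _ inf_hom_linear])
  show "linear_map F zero_module Hom_Q (\<lambda>_. \<zero>\<^bsub>Hom_Q\<^esub>)"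
    using module_zero_module[OF F.cring_axioms] module_Hom_Q by (rule linear_map_const_zero)
  show "inf_hom L H \<zero>\<^bsub>Hom_Q\<^esub> = \<zero>\<^bsub>Hom_L\<^esub>"
    using linear_map_zero[OF inf_hom_linear] .
  fix f assume f: "f \<in> carrier Hom_Q" and zero: "inf_hom L H f = \<zero>\<^bsub>Hom_L\<^esub>"
  have "f X = \<zero>" if X: "X \<in> carrier Q" for X
  proof -
    obtain x where x: "x \<in> carrier L" "X = \<pi> x" using X by (auto simp: carrier_quotient)
    then have "f X = inf_hom L H f x" by simp
    also have "\<dots> = \<zero>" unfolding zero using x by simp
    finally show ?thesis .
  qed
  then have "f = \<zero>\<^bsub>Hom_Q\<^esub>" using f by (intro extensionalityI[where A = "carrier Q"]) auto
  then show "\<exists>x\<in>carrier zero_module. f = \<zero>\<^bsub>Hom_Q\<^esub>" by (auto simp: zero_module_def)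
qed

lemma exact_at_Hom_L:
  "exact_at F Hom_Q (inf_hom L H) Hom_L (res_hom H) Hom_H"
proof (rule exact_atI[OF inf_hom_linear res_hom_linear])
  fix f assume f: "f \<in> carrier Hom_Q"
  then have "f (\<pi> h) = \<zero>" if "h \<in> H" for h
    using that proj_zero_iff[of h] H_closed linear_map_zero[of F Q K f] by simp
  then show "res_hom H (inf_hom L H f) = \<zero>\<^bsub>Hom_H\<^esub>"
    by (auto simp: res_hom_def H_closed intro!: restrict_ext)
next
  fix g assume g: "g \<in> carrier Hom_L" and zero: "res_hom H g = \<zero>\<^bsub>Hom_H\<^esub>"
  have g_lin: "linear_map F L K g" using g by simp
  have g_H: "g h = \<zero>" if "h \<in> H" for h
    using fun_cong[OF zero, of h] that by (simp add: res_hom_def)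
  obtain \<mu> where \<mu>: "\<mu> \<in> lie_sections F L H" using section_exists by blast
  \<comment> \<open>\<open>x - \<mu> (\<pi> x)\<close> lies in \<open>H\<close>, where
    \<open>g\<close> vanishes. Hence \<open>g\<close> factors through \<pi>, with
    \<open>g \<circ> \<mu>\<close> as the induced functional.\<close>
  have g_proj: "g (\<mu> (\<pi> x)) = g x" if x: "x \<in> carrier L" for x
  proof -
    have m: "\<mu> (\<pi> x) \<in> carrier L" using x \<mu> by (simp add: section_closed)
    have "g x \<ominus> g (\<mu> (\<pi> x)) = \<zero>"
      using g_H[OF lift_defect_H[OF \<mu> x]] functionalD(6)[OF g_lin x m] by (simp add: lift_defect_def)
    then show ?thesis
      using functionalD(1)[OF g_lin] x m by (simp add: F.minus_eq_zero_iff)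
  qed
  let ?f = "\<lambda>X\<in>carrier Q. g (\<mu> X)"
  have "linear_map F Q K ?f"
    by (rule quot.functional_restrict[OF linear_map_compose[OF section_linear[OF \<mu>] g_lin]])
  then have "?f \<in> carrier Hom_Q" using g derived_closed g_proj by (auto simp: subset_iff)
  moreover have "g = inf_hom L H ?f"
    by (rule extensionalityI[where A = "carrier L"])
      (use g g_proj in \<open>simp_all, simp add: inf_hom_def\<close>)
  ultimately show "\<exists>f\<in>carrier Hom_Q. g = inf_hom L H f" by blast
qed

lemma exact_at_Hom_H:
  "exact_at F Hom_L (res_hom H) Hom_H (tra F L H) (H2 F Q)"
proof (rule exact_atI[OF res_hom_linear tra_linear])
  obtain \<mu> where \<mu>: "\<mu> \<in> lie_sections F L H" using section_exists by blast
  note \<mu>_lin = section_linear[OF \<mu>]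
  \<comment> \<open>Surjectivity of \<pi> turns a condition on pairs from the quotient into one on
    brackets in \<open>L\<close>.\<close>
  have tra_zero_iff: "tra F L H \<alpha> = \<zero>\<^bsub>H2 F Q\<^esub> \<longleftrightarrow>
      (\<exists>\<sigma>. linear_map F Q K \<sigma> \<and> (\<forall>x\<in>carrier L. \<forall>y\<in>carrier L.
        \<alpha> (lift_defect \<mu> (bracket L x y)) = \<sigma> (\<pi> (bracket L x y))))"
    if \<alpha>: "linear_map F R K \<alpha>" for \<alpha>
    unfolding tra_eq[OF \<mu> \<alpha>] quot.H2_class_eq_zero_iff[OF tra_cochain_cocycle[OF \<mu> \<alpha>]]
    by (simp add: carrier_quotient tra_cochain_proj[OF \<mu>] bracket_quotient)
  {
    fix g assume g: "g \<in> carrier Hom_L"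
    then have g_lin: "linear_map F L K g" by simp
    have res_lin: "linear_map F R K (res_hom H g)"
      using linear_map_closed[OF res_hom_linear g] by simp
    \<comment> \<open>The witness: on a bracket \<open>b\<close> the functional \<open>g\<close> is
      zero, so on \<open>b - \<mu> (\<pi> b)\<close> it takes the value
      \<open>- g (\<mu> (\<pi> b))\<close>.\<close>
    have "linear_map F Q K (\<lambda>X. \<ominus>\<^bsub>K\<^esub> g (\<mu> X))"
      by (rule linear_map_neg[OF linear_map_compose[OF \<mu>_lin g_lin]])
    moreover have "res_hom H g (lift_defect \<mu> b) = \<ominus> g (\<mu> (\<pi> b))" if b: "b \<in> derived" for b
    proof -
      have b': "b \<in> carrier L" "\<mu> (\<pi> b) \<in> carrier L"
        using b derived_closed \<mu> by (auto simp: section_closed subset_iff)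
      have "res_hom H g (lift_defect \<mu> b) = g b \<ominus> g (\<mu> (\<pi> b))"
        using lift_defect_H[OF \<mu> b'(1)] functionalD(6)[OF g_lin b']
        by (simp add: res_hom_def) (simp add: lift_defect_def)
      then show ?thesis using g b functionalD(1)[OF g_lin b'(2)] by (simp add: a_minus_def)
    qed
    ultimately show "tra F L H (res_hom H g) = \<zero>\<^bsub>H2 F Q\<^esub>"
      unfolding tra_zero_iff[OF res_lin] using bracket_derived by auto
  }
  fix \<alpha> assume \<alpha>: "\<alpha> \<in> carrier Hom_H" and "tra F L H \<alpha> = \<zero>\<^bsub>H2 F Q\<^esub>"
  then have \<alpha>_lin: "linear_map F R K \<alpha>" by simp
  obtain \<sigma> where \<sigma>: "linear_map F Q K \<sigma>"
    and \<alpha>_\<sigma>: "\<And>b. b \<in> derived \<Longrightarrow> \<alpha> (lift_defect \<mu> b) = \<sigma> (\<pi> b)"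
    using \<open>tra F L H \<alpha> = _\<close> unfolding tra_zero_iff[OF \<alpha>_lin] derived_def by blast
  define g where "g = (\<lambda>x\<in>carrier L. \<alpha> (lift_defect \<mu> x) \<ominus>\<^bsub>K\<^esub> \<sigma> (\<pi> x))"
  have "linear_map F L K g"
    unfolding g_def
    by (rule functional_restrict[OF linear_map_diff[OF linear_map_compose[OF lift_defect_linear[OF \<mu>] \<alpha>_lin]
            linear_map_compose[OF proj_linear \<sigma>]]])
  moreover have "g b = \<zero>" if "b \<in> derived" for b
    using that derived_closed \<alpha>_\<sigma>[OF that] quot.functionalD(1)[OF \<sigma>, of "\<pi> b"]
    by (auto simp: g_def a_minus_def F.r_neg)
  ultimately have "g \<in> carrier Hom_L" by (simp add: g_def)
  moreover have "\<alpha> = res_hom H g"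
  proof (rule extensionalityI[where A = H])
    fix h assume h: "h \<in> H"
    \<comment> \<open>On \<open>H\<close> the defect is the identity and \<pi> is zero, so
      \<open>g\<close> restricts to \<alpha>.\<close>
    have "\<sigma> (\<pi> h) = \<zero>"
      using h H_closed[OF h] proj_zero_iff[of h] linear_map_zero[OF \<sigma>] by simp
    then show "\<alpha> h = res_hom H g h"
      using h H_closed[OF h] lift_defect_id[OF \<mu> h] linear_map_closed[OF \<alpha>_lin, of h]
      by (simp add: res_hom_def g_def F.minus_zero_right)
  qed (use \<alpha> in \<open>simp_all add: res_hom_def\<close>)
  ultimately show "\<exists>g\<in>carrier Hom_L. \<alpha> = res_hom H g" by blast
qed

lemma exact_at_H2_Q:
  "exact_at F Hom_H (tra F L H) (H2 F Q) (inf_H2 F L H) (H2 F L)"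
proof (rule exact_atI[OF tra_linear inf_H2_linear])
  obtain \<mu> where \<mu>: "\<mu> \<in> lie_sections F L H" using section_exists by blast
  note \<mu>_lin = section_linear[OF \<mu>]
  {
    fix \<alpha> assume "\<alpha> \<in> carrier Hom_H"
    then have \<alpha>: "linear_map F R K \<alpha>" by simp
    have cocycle: "tra_cochain \<mu> \<alpha> \<in> cocycles2 F Q" by (rule tra_cochain_cocycle[OF \<mu> \<alpha>])
    have "linear_map F L K (\<lambda>x. \<alpha> (lift_defect \<mu> x))"
      by (rule linear_map_compose[OF lift_defect_linear[OF \<mu>] \<alpha>])
    then show "inf_H2 F L H (tra F L H \<alpha>) = \<zero>\<^bsub>H2 F L\<^esub>"
      unfolding tra_eq[OF \<mu> \<alpha>] inf_H2_class[OF cocycle]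
        H2_class_eq_zero_iff[OF inf_cochain_cocycle[OF cocycle]]
      using tra_cochain_proj[OF \<mu>] by auto
  }
  fix c assume "c \<in> carrier (H2 F Q)" and zero: "inf_H2 F L H c = \<zero>\<^bsub>H2 F L\<^esub>"
  then obtain \<beta> where \<beta>: "\<beta> \<in> cocycles2 F Q" and c: "c = H2_class F Q \<beta>"
    by (auto simp: quot.carrier_H2)
  obtain \<sigma> where \<sigma>: "linear_map F L K \<sigma>"
    and \<beta>_\<sigma>: "\<And>x y. \<lbrakk>x \<in> carrier L; y \<in> carrier L\<rbrakk> \<Longrightarrow> \<beta> (\<pi> x, \<pi> y) = \<sigma> (bracket L x y)"
    using zero unfolding c inf_H2_class[OF \<beta>] H2_class_eq_zero_iff[OF inf_cochain_cocycle[OF \<beta>]]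
    by auto
  have \<alpha>_lin: "linear_map F R K (\<lambda>h\<in>H. \<sigma> h)"
    by (rule linear_map_cong[OF linear_map_compose[OF inclusion_linear \<sigma>]]) simp
  then have "(\<lambda>h\<in>H. \<sigma> h) \<in> carrier Hom_H" by simp
  moreover have "c = tra F L H (\<lambda>h\<in>H. \<sigma> h)"
    unfolding c tra_eq[OF \<mu> \<alpha>_lin] quot.H2_class_eq_iff[OF \<beta> tra_cochain_cocycle[OF \<mu> \<alpha>_lin]]
  proof (intro exI conjI ballI)
    show "linear_map F Q K (\<lambda>X. \<sigma> (\<mu> X))" by (rule linear_map_compose[OF \<mu>_lin \<sigma>])
    fix X Y assume "X \<in> carrier Q" "Y \<in> carrier Q"
    then obtain x y where x: "x \<in> carrier L" "X = \<pi> x" and y: "y \<in> carrier L" "Y = \<pi> y"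
      by (auto simp: carrier_quotient)
    let ?b = "bracket L x y"
    have b: "?b \<in> carrier L" and m: "\<mu> (\<pi> ?b) \<in> carrier L"
      using x y \<mu> by (simp_all add: section_closed)
    \<comment> \<open>Splitting the bracket into its defect and its lifted class separates the
      transgression term from the coboundary term.\<close>
    have "\<sigma> ?b = (\<sigma> ?b \<ominus> \<sigma> (\<mu> (\<pi> ?b))) \<oplus> \<sigma> (\<mu> (\<pi> ?b))"
      using functionalD(1)[OF \<sigma> b] functionalD(1)[OF \<sigma> m] by (simp add: a_minus_def F.a_assoc F.l_neg)
    also have "\<sigma> ?b \<ominus> \<sigma> (\<mu> (\<pi> ?b)) = \<sigma> (lift_defect \<mu> ?b)"
      using functionalD(6)[OF \<sigma> b m] by (simp add: lift_defect_def)
    finally show "\<beta> (X, Y) = tra_cochain \<mu> (\<lambda>h\<in>H. \<sigma> h) (X, Y) \<oplus> \<sigma> (\<mu> (bracket Q X Y))"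
      using x y b lift_defect_H[OF \<mu> b] by (simp add: \<beta>_\<sigma> tra_cochain_proj[OF \<mu>] bracket_quotient)
  qed
  ultimately show "\<exists>\<alpha>\<in>carrier Hom_H. c = tra F L H \<alpha>" by blast
qed

end

theorem theorem5:
  fixes F :: "('f, 'm) ring_scheme" and L :: "('f, 'a) lie_superalgebra" and H :: "'a set"
  assumes "field F"
    and "[(2::nat)] \<cdot>\<^bsub>F\<^esub> \<one>\<^bsub>F\<^esub> \<noteq> \<zero>\<^bsub>F\<^esub>" and "[(3::nat)] \<cdot>\<^bsub>F\<^esub> \<one>\<^bsub>F\<^esub> \<noteq> \<zero>\<^bsub>F\<^esub>"
    and "lie_superalgebra F L"
    and "lie_subalgebra F L H" and "H \<subseteq> lie_center L"
  shows
    "exact_at F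
       zero_module
       (\<lambda>_. \<zero>\<^bsub>hom_space F L (adjoint_quotient L H) (trivial_module F)\<^esub>)
       (hom_space F L (adjoint_quotient L H) (trivial_module F))
       (inf_hom L H)
       (hom_space F L (adjoint_module L) (trivial_module F)) \<and>
     exact_at F
       (hom_space F L (adjoint_quotient L H) (trivial_module F))
       (inf_hom L H)
       (hom_space F L (adjoint_module L) (trivial_module F))
       (res_hom H)
       (hom_space F L (adjoint_sub L H) (trivial_module F)) \<and>
     exact_at F
       (hom_space F L (adjoint_module L) (trivial_module F))
       (res_hom H)
       (hom_space F L (adjoint_sub L H) (trivial_module F))
       (tra F L H)
       (H2 F (lie_quotient L H)) \<and>
     exact_at F
       (hom_space F L (adjoint_sub L H) (trivial_module F))
       (tra F L H)
       (H2 F (lie_quotient L H))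
       (inf_H2 F L H)
       (H2 F L)"
proof -
  interpret field F by fact
  interpret lie_superalgebra F L by fact
  interpret central_extension F L H
    by unfold_locales (fact assms(5), fact assms(6))
  show ?thesis
    \<comment> \<open>Here the equivariant Hom spaces become the spaces of functionals for which
      exactness was shown.\<close>
    unfolding hom_space_adjoint hom_space_quotient hom_space_sub
    using exact_at_Hom_Q exact_at_Hom_L exact_at_Hom_H exact_at_H2_Q by blast
qed

end
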